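(* The algorithm "Fast Application of $Q^\top$ to a Vector" described in the context computes $\mathbf{c}=Q^\top\mathbf{b}$ in $O(n)$ operations (with $r,p,\ell,m$ bounded by constants independent of $n$).
   Context: Notation: $M[a:b,c:d]$ is the submatrix of $M$ with rows $a,\dots,b$ and columns $c,\dots,d$; ":" alone means all indices. $V_n[k,:]$ and $U[k,:]$ are regarded as vectors in $\mathbb{R}^r$. $\odot$ is the element-wise product. $\operatorname{tril}(M,-1)$ and $\operatorname{triu}(M,1)$ are the strictly lower and strictly upper triangular parts of $M$. $\mathbf{e}_k$ is the $k$-th standard basis vector of $\mathbb{R}^n$. $\mathrm{BM}_{(\ell,m)}^{n\times n}$ is the set of $B=(b_{kj})\in\mathbb{R}^{n\times n}$ with $b_{kj}=0$ whenever $k-j>\ell$ or $j-k>m$. $A\in \mathrm{BPS}_{(r,p),(\ell,m)}^{n\times n}$ if $A=B+\operatorname{tril}(UV^\top,-1)+\operatorname{triu}(WS^\top,1)$ for some $U,V\in\mathbb{R}^{n\times r}$, $W,S\in\mathbb{R}^{n\times p}$, $B\in \mathrm{BM}_{(\ell,m)}^{n\times n}$. Setting: $A=QR\in \mathrm{BPS}_{(r,p),(\ell,m)}^{n\times n}$ is factorized by Householder reflections, $Q=(I-\tau_1\mathbf{y}_1\mathbf{y}_1^\top)\cdots(I-\tau_{n-1}\mathbf{y}_{n-1}\mathbf{y}_{n-1}^\top)$ with $\tau_k=2\|\mathbf{y}_k\|_2^{-2}$, and $R$ upper triangular. The factor matrix $F$ has $R$ as upper triangular part, and stores the Householder vectors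 below the diagonal: $\mathbf{y}_k[j]=0$ for $j<k$, $\mathbf{y}_k[k]=1$, $\mathbf{y}_k[j]=F[j,k]$ for $j>k$. It has the form $F=B_n+\operatorname{tril}(UV_n^\top,-1)+\operatorname{triu}(W_n\tilde S^\top,1)\in \mathrm{BPS}_{(r,r+p),(\ell,\ell+m)}^{n\times n}$ with $U,V_n\in\mathbb{R}^{n\times r}$, $W_n,\tilde S\in\mathbb{R}^{n\times(r+p)}$, $B_n\in \mathrm{BM}_{(\ell,\ell+m)}^{n\times n}$. Let $\tilde U_k\in\mathbb{R}^{n\times r}$ have $\tilde U_k[1:k,:]=\mathbf{0}$ and $\tilde U_k[k+1:n,:]=U[k+1:n,:]$. Thus $\mathbf{y}_k=\mathbf{e}_k+\tilde U_kV_n[k,:]+\mathbf{d}_k$, where $\mathbf{d}_k\in\mathbb{R}^n$ has $\mathbf{d}_k[j]=B_n[j,k]$ for $j=k+1,\dots,\min(k+\ell,n)$ and is zero elsewhere. Algorithm (Fast Application of $Q^\top$ to a Vector). Input: $F$ in the structured form above, $\boldsymbol{\tau}=[\tau_1,\dots,\tau_{n-1},0]^\top$, $\mathbf{b}\in\mathbb{R}^n$. Output: $\mathbf{c}\in\mathbb{R}^n$. Initialize $O=\mathbf{0}_{n\times r}$, $G=\mathbf{0}_{n\times(\ell+1)}$, $\mathbf{h}=\mathbf{0}_r$; denote by $\mathbf{o}_j$, $\mathbf{g}_j$ the $j$-th columns of $O$, $G$. At every stage $k$ (after $k$ iterations, $k=0,\dots,n-1$) the current vector is represented implicitly, through the current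 values of $\mathbf{h},O,G$, as $\mathbf{b}^{(k)}=\mathbf{b}+\tilde U_k\mathbf{h}+\sum_{j=1}^r\mathbf{o}_j+\sum_{j=1}^{\ell+1}\mathbf{g}_j$. For $k=1,\dots,n-1$: (1) compute $c=\mathbf{y}_k^\top\mathbf{b}^{(k-1)}$, exploiting the structure of $\mathbf{y}_k$ and precomputed lookup tables so that this takes $O(1)$ operations; (2) set $O[k,:]=U[k,:]\odot\mathbf{h}$; (3) set $\mathbf{h}\leftarrow\mathbf{h}-\tau_k c\,V_n[k,:]$; (4) set $G[k,1]=-\tau_kc$ and, for $t=1,\dots,\min(\ell,n-k)$, set $G[k+t,t+1]=-\tau_kc\,B_n[k+t,k]$. Finally return $\mathbf{c}=\mathbf{b}+\tilde U_{n-1}\mathbf{h}+\sum_{j=1}^r\mathbf{o}_j+\sum_{j=1}^{\ell+1}\mathbf{g}_j$. *)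

theory Defs
  imports Complex_Main "Jordan_Normal_Form.Matrix"
begin

text \<open>All rows, columns and vector entries are numbered from 0, as in the matrix library.\<close>

section \<open>Banded-plus-semiseparable matrices\<close>

definition band_mats :: "nat \<Rightarrow> nat \<Rightarrow> nat \<Rightarrow> real mat set" where
  "band_mats n l m = {B \<in> carrier_mat n n.
     \<forall>k<n. \<forall>j<n. k > j + l \<or> j > k + m \<longrightarrow> B $$ (k, j) = 0}"

definition strict_tril :: "real mat \<Rightarrow> real mat" where
  "strict_tril M = mat (dim_row M) (dim_col M) (\<lambda>(i, j). if j < i then M $$ (i, j) else 0)"

definition strict_triu :: "real mat \<Rightarrow> real mat" where
  "strict_triu M = mat (dim_row M) (dim_col M) (\<lambda>(i, j). if i < j then M $$ (i, j) else 0)"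

definition bps_repr ::
  "nat \<Rightarrow> nat \<Rightarrow> nat \<Rightarrow> nat \<Rightarrow> nat \<Rightarrow> real mat \<Rightarrow>
   real mat \<Rightarrow> real mat \<Rightarrow> real mat \<Rightarrow> real mat \<Rightarrow> real mat \<Rightarrow> bool" where
  "bps_repr n r p l m A B U V W S \<longleftrightarrow>
     U \<in> carrier_mat n r \<and> V \<in> carrier_mat n r \<and>
     W \<in> carrier_mat n p \<and> S \<in> carrier_mat n p \<and>
     B \<in> band_mats n l m \<and>
     A = B + strict_tril (U * transpose_mat V) + strict_triu (W * transpose_mat S)"

definition bps_mats :: "nat \<Rightarrow> nat \<Rightarrow> nat \<Rightarrow> nat \<Rightarrow> nat \<Rightarrow> real mat set" where
  "bps_mats n r p l m = {A. \<exists>B U V W S. bps_repr n r p l m A B U V W S}"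

section \<open>Householder QR factorization\<close>

definition norm2 :: "real vec \<Rightarrow> real" where
  "norm2 v = sqrt (v \<bullet> v)"

definition reflector :: "nat \<Rightarrow> real \<Rightarrow> real vec \<Rightarrow> real mat" where
  "reflector n t y = 1\<^sub>m n - t \<cdot>\<^sub>m mat n n (\<lambda>(i, j). y $ i * y $ j)"

definition hh_vec :: "nat \<Rightarrow> real mat \<Rightarrow> nat \<Rightarrow> real vec" where
  "hh_vec n F k = vec n (\<lambda>j. if j < k then 0 else if j = k then 1 else F $$ (j, k))"

text \<open>\<open>foldr\<close> yields the product of the reflectors \<open>0, \<dots>, n - 2\<close> in this order from left to
  right.\<close>

definition hh_Q :: "nat \<Rightarrow> real mat \<Rightarrow> real vec \<Rightarrow> real mat" where
  "hh_Q n F tau = foldr (\<lambda>k M. reflector n (tau $ k) (hh_vec n F k) * M) [0..<n - 1] (1\<^sub>m n)"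

definition householder_qr ::
  "nat \<Rightarrow> real mat \<Rightarrow> real mat \<Rightarrow> real mat \<Rightarrow> real mat \<Rightarrow> real vec \<Rightarrow> bool" where
  "householder_qr n A Q R F tau \<longleftrightarrow>
     A \<in> carrier_mat n n \<and> R \<in> carrier_mat n n \<and> F \<in> carrier_mat n n \<and> tau \<in> carrier_vec n \<and>
     (\<forall>k<n - 1. tau $ k = 2 / (norm2 (hh_vec n F k))\<^sup>2) \<and> tau $ (n - 1) = 0 \<and>
     Q = hh_Q n F tau \<and> upper_triangular R \<and> A = Q * R \<and>
     (\<forall>i<n. \<forall>j<n. i \<le> j \<longrightarrow> F $$ (i, j) = R $$ (i, j))"

section \<open>Programs and their operation count\<close>

text \<open>A program works on natural-number registers, used for sizes and loop counters, and on
  real arrays addressed by lists of indices (a scalar is an array with the index list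
  \<open>[]\<close>). Every constant, register or array access, arithmetic operation, assignment, loop set-up
  and loop iteration counts as one operation, so that the count bounds in particular the number of
  floating-point operations.\<close>

datatype iexp =
    Ic nat
  | Iv string
  | Iadd iexp iexp (infixl \<open>+\<^sub>i\<close> 65)
  | Isub iexp iexp (infixl \<open>-\<^sub>i\<close> 65)
  | Imin iexp iexp

datatype rexp =
    Rc real
  | Rd string "iexp list" (infix \<open>@:\<close> 90)
  | Rneg rexp
  | Radd rexp rexp (infixl \<open>+\<^sub>r\<close> 65)
  | Rsub rexp rexp (infixl \<open>-\<^sub>r\<close> 65)
  | Rmul rexp rexp (infixl \<open>*\<^sub>r\<close> 70)

datatype com =
    Assign string "iexp list" rexp (\<open>(_ @: _ ::=/ _)\<close> [91, 91, 62] 62)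
  | Seq com com (infixr \<open>;;\<close> 60)
  | For string iexp iexp com (\<open>(FOR _ FROM _ BELOW _ DO/ _)\<close> [0, 0, 0, 61] 61)

record state =
  reg :: "string \<Rightarrow> nat"
  arr :: "string \<Rightarrow> nat list \<Rightarrow> real"

primrec ival :: "iexp \<Rightarrow> state \<Rightarrow> nat" where
  "ival (Ic c) s = c"
| "ival (Iv x) s = reg s x"
| "ival (a +\<^sub>i b) s = ival a s + ival b s"
| "ival (a -\<^sub>i b) s = ival a s - ival b s"
| "ival (Imin a b) s = min (ival a s) (ival b s)"

primrec icost :: "iexp \<Rightarrow> nat" where
  "icost (Ic c) = 1"
| "icost (Iv x) = 1"
| "icost (a +\<^sub>i b) = 1 + icost a + icost b"
| "icost (a -\<^sub>i b) = 1 + icost a + icost b"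
| "icost (Imin a b) = 1 + icost a + icost b"

primrec rval :: "rexp \<Rightarrow> state \<Rightarrow> real" where
  "rval (Rc c) s = c"
| "rval (x @: is) s = arr s x (map (\<lambda>a. ival a s) is)"
| "rval (Rneg e) s = - rval e s"
| "rval (e +\<^sub>r f) s = rval e s + rval f s"
| "rval (e -\<^sub>r f) s = rval e s - rval f s"
| "rval (e *\<^sub>r f) s = rval e s * rval f s"

primrec rcost :: "rexp \<Rightarrow> nat" where
  "rcost (Rc c) = 1"
| "rcost (x @: is) = 1 + sum_list (map icost is)"
| "rcost (Rneg e) = 1 + rcost e"
| "rcost (e +\<^sub>r f) = 1 + rcost e + rcost f"
| "rcost (e -\<^sub>r f) = 1 + rcost e + rcost f"
| "rcost (e *\<^sub>r f) = 1 + rcost e + rcost f"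

text \<open>\<open>exec c s\<close> is the final state together with the number of operations performed. The bounds of
  a loop are evaluated once, on entry, and the upper bound is exclusive.\<close>

primrec exec :: "com \<Rightarrow> state \<Rightarrow> state \<times> nat" where
  "exec (x @: is ::= e) s =
     (s\<lparr>arr := (arr s)(x := (arr s x)(map (\<lambda>a. ival a s) is := rval e s))\<rparr>,
      1 + sum_list (map icost is) + rcost e)"
| "exec (c ;; d) s =
     (let (s1, t1) = exec c s; (s2, t2) = exec d s1 in (s2, t1 + t2))"
| "exec (FOR x FROM a BELOW b DO c) s =
     fold (\<lambda>i (s1, t1). let (s2, t2) = exec c (s1\<lparr>reg := (reg s1)(x := i)\<rparr>) in (s2, t1 + 1 + t2))
       [ival a s..<ival b s] (s, 1 + icost a + icost b)"

section \<open>Fast application of the transposed orthogonal factor\<close>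

definition init_prog :: com where
  "init_prog =
     FOR ''i'' FROM Ic 0 BELOW Iv ''n'' DO (
       (FOR ''j'' FROM Ic 0 BELOW Iv ''r'' DO
          ''O'' @: [Iv ''i'', Iv ''j''] ::= Rc 0) ;;
       (FOR ''j'' FROM Ic 0 BELOW Iv ''l'' +\<^sub>i Ic 1 DO
          ''G'' @: [Iv ''i'', Iv ''j''] ::= Rc 0)) ;;
     FOR ''j'' FROM Ic 0 BELOW Iv ''r'' DO
       ''h'' @: [Iv ''j''] ::= Rc 0"

text \<open>Let \<open>Ut k\<close> be \<open>U\<close> with its first \<open>k\<close> rows set to zero. The lookup tables are
  \<open>P[k, :] = (Ut k)\<^sup>T b\<close> and \<open>T[k, :, :] = (Ut k)\<^sup>T (Ut k)\<close> for \<open>k = n, n - 1, \<dots>, 0\<close>. Both are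
  suffix sums over the rows of \<open>U\<close>; the current row in the loop is \<open>n - 1 - i\<close>.\<close>

definition table_prog :: com where
  "table_prog =
     FOR ''j'' FROM Ic 0 BELOW Iv ''r'' DO (
       ''P'' @: [Iv ''n'', Iv ''j''] ::= Rc 0 ;;
       (FOR ''q'' FROM Ic 0 BELOW Iv ''r'' DO
          ''T'' @: [Iv ''n'', Iv ''j'', Iv ''q''] ::= Rc 0)) ;;
     FOR ''i'' FROM Ic 0 BELOW Iv ''n'' DO
       FOR ''j'' FROM Ic 0 BELOW Iv ''r'' DO (
         ''P'' @: [Iv ''n'' -\<^sub>i Ic 1 -\<^sub>i Iv ''i'', Iv ''j''] ::=
            ''P'' @: [Iv ''n'' -\<^sub>i Iv ''i'', Iv ''j''] +\<^sub>r
            ''U'' @: [Iv ''n'' -\<^sub>i Ic 1 -\<^sub>i Iv ''i'', Iv ''j''] *\<^sub>r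
            ''b'' @: [Iv ''n'' -\<^sub>i Ic 1 -\<^sub>i Iv ''i''] ;;
         (FOR ''q'' FROM Ic 0 BELOW Iv ''r'' DO
            ''T'' @: [Iv ''n'' -\<^sub>i Ic 1 -\<^sub>i Iv ''i'', Iv ''j'', Iv ''q''] ::=
               ''T'' @: [Iv ''n'' -\<^sub>i Iv ''i'', Iv ''j'', Iv ''q''] +\<^sub>r
               ''U'' @: [Iv ''n'' -\<^sub>i Ic 1 -\<^sub>i Iv ''i'', Iv ''j''] *\<^sub>r
               ''U'' @: [Iv ''n'' -\<^sub>i Ic 1 -\<^sub>i Iv ''i'', Iv ''q'']))"

text \<open>The inner product \<open>z = y\<^sub>k\<^sup>T x\<close>, where \<open>x = b + (Ut k) h + \<Sum>\<^sub>j O[:, j] + \<Sum>\<^sub>j G[:, j]\<close> is the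
  implicitly represented current vector and \<open>y\<^sub>k = e\<^sub>k + Ut (k + 1) V[k, :] + d\<^sub>k\<close>.
  Before iteration \<open>k\<close>, the rows \<open>k, k + 1, \<dots>\<close> of \<open>O\<close> and the rows \<open>k + l, k + l + 1, \<dots>\<close> of \<open>G\<close>
  are zero. With \<open>w = min l (n - 1 - k)\<close>, \<open>g[t] = \<Sum>\<^sub>j G[k + t, j]\<close> and
  \<open>x[t] = b[k + t] + U[k + t, :] h + g[t]\<close> for \<open>t = 0, \<dots>, w\<close>, the three summands of \<open>y\<^sub>k\<close> contribute
  \<open>x[0]\<close>, then
  \<open>V[k, :]\<^sup>T (P[k + 1, :] + T[k + 1, :, :] h + \<Sum>\<^sub>t\<^sub>\<ge>\<^sub>1 U[k + t, :] g[t])\<close>, and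
  \<open>\<Sum>\<^sub>t\<^sub>\<ge>\<^sub>1 B[k + t, k] x[t]\<close>.\<close>

definition inner_prog :: com where
  "inner_prog =
     FOR ''t'' FROM Ic 0 BELOW Imin (Iv ''l'') (Iv ''n'' -\<^sub>i Ic 1 -\<^sub>i Iv ''k'') +\<^sub>i Ic 1 DO (
       ''g'' @: [Iv ''t''] ::= Rc 0 ;;
       (FOR ''j'' FROM Ic 0 BELOW Iv ''l'' +\<^sub>i Ic 1 DO
          ''g'' @: [Iv ''t''] ::= ''g'' @: [Iv ''t''] +\<^sub>r
             ''G'' @: [Iv ''k'' +\<^sub>i Iv ''t'', Iv ''j'']) ;;
       ''x'' @: [Iv ''t''] ::= ''b'' @: [Iv ''k'' +\<^sub>i Iv ''t''] +\<^sub>r ''g'' @: [Iv ''t''] ;;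
       (FOR ''j'' FROM Ic 0 BELOW Iv ''r'' DO
          ''x'' @: [Iv ''t''] ::= ''x'' @: [Iv ''t''] +\<^sub>r
             ''U'' @: [Iv ''k'' +\<^sub>i Iv ''t'', Iv ''j''] *\<^sub>r ''h'' @: [Iv ''j''])) ;;
     ''z'' @: [] ::= ''x'' @: [Ic 0] ;;
     (FOR ''j'' FROM Ic 0 BELOW Iv ''r'' DO (
        ''a'' @: [] ::= ''P'' @: [Iv ''k'' +\<^sub>i Ic 1, Iv ''j''] ;;
        (FOR ''q'' FROM Ic 0 BELOW Iv ''r'' DO
           ''a'' @: [] ::= ''a'' @: [] +\<^sub>r
              ''T'' @: [Iv ''k'' +\<^sub>i Ic 1, Iv ''j'', Iv ''q''] *\<^sub>r ''h'' @: [Iv ''q'']) ;;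
        (FOR ''t'' FROM Ic 1 BELOW Imin (Iv ''l'') (Iv ''n'' -\<^sub>i Ic 1 -\<^sub>i Iv ''k'') +\<^sub>i Ic 1 DO
           ''a'' @: [] ::= ''a'' @: [] +\<^sub>r
              ''U'' @: [Iv ''k'' +\<^sub>i Iv ''t'', Iv ''j''] *\<^sub>r ''g'' @: [Iv ''t'']) ;;
        ''z'' @: [] ::= ''z'' @: [] +\<^sub>r ''V'' @: [Iv ''k'', Iv ''j''] *\<^sub>r ''a'' @: [])) ;;
     FOR ''t'' FROM Ic 1 BELOW Imin (Iv ''l'') (Iv ''n'' -\<^sub>i Ic 1 -\<^sub>i Iv ''k'') +\<^sub>i Ic 1 DO
       ''z'' @: [] ::= ''z'' @: [] +\<^sub>r
          ''B'' @: [Iv ''k'' +\<^sub>i Iv ''t'', Iv ''k''] *\<^sub>r ''x'' @: [Iv ''t'']"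

definition update_prog :: com where
  "update_prog =
     FOR ''j'' FROM Ic 0 BELOW Iv ''r'' DO
       ''O'' @: [Iv ''k'', Iv ''j''] ::=
          ''U'' @: [Iv ''k'', Iv ''j''] *\<^sub>r ''h'' @: [Iv ''j''] ;;
     (FOR ''j'' FROM Ic 0 BELOW Iv ''r'' DO
        ''h'' @: [Iv ''j''] ::= ''h'' @: [Iv ''j''] -\<^sub>r
           ''tau'' @: [Iv ''k''] *\<^sub>r ''z'' @: [] *\<^sub>r ''V'' @: [Iv ''k'', Iv ''j'']) ;;
     ''G'' @: [Iv ''k'', Ic 0] ::= Rneg (''tau'' @: [Iv ''k''] *\<^sub>r ''z'' @: []) ;;
     FOR ''t'' FROM Ic 1 BELOW Imin (Iv ''l'') (Iv ''n'' -\<^sub>i Ic 1 -\<^sub>i Iv ''k'') +\<^sub>i Ic 1 DO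
       ''G'' @: [Iv ''k'' +\<^sub>i Iv ''t'', Iv ''t''] ::=
          Rneg (''tau'' @: [Iv ''k''] *\<^sub>r ''z'' @: []) *\<^sub>r
          ''B'' @: [Iv ''k'' +\<^sub>i Iv ''t'', Iv ''k'']"

text \<open>Only the last row of \<open>Ut (n - 1)\<close> can be nonzero, so \<open>Ut (n - 1) h\<close> affects only the last
  entry of the result.\<close>

definition output_prog :: com where
  "output_prog =
     FOR ''i'' FROM Ic 0 BELOW Iv ''n'' DO (
       ''c'' @: [Iv ''i''] ::= ''b'' @: [Iv ''i''] ;;
       (FOR ''j'' FROM Ic 0 BELOW Iv ''r'' DO
          ''c'' @: [Iv ''i''] ::= ''c'' @: [Iv ''i''] +\<^sub>r ''O'' @: [Iv ''i'', Iv ''j'']) ;;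
       (FOR ''j'' FROM Ic 0 BELOW Iv ''l'' +\<^sub>i Ic 1 DO
          ''c'' @: [Iv ''i''] ::= ''c'' @: [Iv ''i''] +\<^sub>r ''G'' @: [Iv ''i'', Iv ''j''])) ;;
     FOR ''j'' FROM Ic 0 BELOW Iv ''r'' DO
       ''c'' @: [Iv ''n'' -\<^sub>i Ic 1] ::= ''c'' @: [Iv ''n'' -\<^sub>i Ic 1] +\<^sub>r
          ''U'' @: [Iv ''n'' -\<^sub>i Ic 1, Iv ''j''] *\<^sub>r ''h'' @: [Iv ''j'']"

definition fast_apply_Qt :: com where
  "fast_apply_Qt =
     init_prog ;;
     table_prog ;;
     (FOR ''k'' FROM Ic 0 BELOW Iv ''n'' -\<^sub>i Ic 1 DO (inner_prog ;; update_prog)) ;;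
     output_prog"

text \<open>The input of the program. The generators \<open>W\<close> and \<open>S\<close> of the upper triangular part
  are not used by the algorithm, and nothing is assumed about the other registers and arrays.\<close>

definition input_state ::
  "nat \<Rightarrow> nat \<Rightarrow> nat \<Rightarrow> real mat \<Rightarrow> real mat \<Rightarrow> real mat \<Rightarrow> real vec \<Rightarrow> real vec \<Rightarrow>
   state \<Rightarrow> bool" where
  "input_state n r l B U V tau b s \<longleftrightarrow>
     reg s ''n'' = n \<and> reg s ''r'' = r \<and> reg s ''l'' = l \<and>
     (\<forall>i<n. \<forall>j<n. arr s ''B'' [i, j] = B $$ (i, j)) \<and>
     (\<forall>i<n. \<forall>j<r. arr s ''U'' [i, j] = U $$ (i, j)) \<and>
     (\<forall>i<n. \<forall>j<r. arr s ''V'' [i, j] = V $$ (i, j)) \<and>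
     (\<forall>i<n. arr s ''tau'' [i] = tau $ i) \<and>
     (\<forall>i<n. arr s ''b'' [i] = b $ i)"

definition output_vec :: "nat \<Rightarrow> state \<Rightarrow> real vec" where
  "output_vec n s = vec n (\<lambda>i. arr s ''c'' [i])"

end

theory Submission
  imports Defs
begin

text \<open>Write \<open>x\<^sub>k\<close> for the result of applying the first \<open>k\<close> reflectors to \<open>b\<close>, so that
  \<open>x\<^sub>n\<^sub>-\<^sub>1\<close> is the transpose of \<open>Q\<close> applied to \<open>b\<close> because reflectors are symmetric. Let \<open>Ut k\<close> be
  \<open>U\<close> with its first \<open>k\<close> rows set to zero. Before iteration \<open>k\<close> the vector \<open>x\<^sub>k\<close> is
  \<open>b + (Ut k) h + \<Sum>\<^sub>j O[:, j] + \<Sum>\<^sub>j G[:, j]\<close>, the rows of \<open>O\<close> from \<open>k\<close> on vanish, and \<open>G[i, j] = 0\<close>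
  whenever \<open>i \<ge> k + j\<close>. The vanishing entries reduce the inner product of \<open>x\<^sub>k\<close> with the Householder
  vector to table entries and at most \<open>l + 1\<close> explicit rows. Subtracting the multiple of the
  Householder vector adds its semiseparable part to \<open>h\<close> and its banded part to \<open>G\<close>; row \<open>k\<close> of
  \<open>(Ut k) h\<close>, lost in the passage to \<open>Ut (k + 1)\<close>, is saved in \<open>O\<close>. Every loop runs at most
  \<open>K + 1\<close> times except the outermost ones, which run at most \<open>n\<close> times and are not nested in each
  other.\<close>

section \<open>Programs\<close>

abbreviation run :: "com \<Rightarrow> state \<Rightarrow> state" where
  "run c s \<equiv> fst (exec c s)"

definition set_reg :: "state \<Rightarrow> string \<Rightarrow> nat \<Rightarrow> state" where
  "set_reg s x i = s\<lparr>reg := (reg s)(x := i)\<rparr>"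

lemma set_reg_sel [simp]:
  "arr (set_reg s x i) = arr s"
  "reg (set_reg s x i) = (reg s)(x := i)"
  by (simp_all add: set_reg_def)

lemma run_Assign:
  "arr (run (x @: is ::= e) s) = (arr s)(x := (arr s x)(map (\<lambda>a. ival a s) is := rval e s))"
  "reg (run (x @: is ::= e) s) = reg s"
  by simp_all

lemma run_Seq: "run (c ;; d) s = run d (run c s)"
  by (simp add: case_prod_beta Let_def)

lemma cost_Seq: "snd (exec (c ;; d) s) = snd (exec c s) + snd (exec d (run c s))"
  by (simp add: case_prod_beta Let_def)

text \<open>The operation counter never influences the state, so a fold over pairs of state and
  count projects to a fold over states. This separates correctness from cost.\<close>

lemma fst_fold_pair:
  assumes "\<And>i p. fst (g i p) = f i (fst p)"
  shows "fst (fold g is p) = fold f is (fst p)"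
  by (induction "is" arbitrary: p) (simp_all add: assms)

lemma run_For:
  "run (FOR x FROM a BELOW b DO c) s =
     fold (\<lambda>i s. run c (set_reg s x i)) [ival a s..<ival b s] s"
  unfolding exec.simps
  by (subst fst_fold_pair[where f = "\<lambda>i s. run c (set_reg s x i)"])
    (simp_all add: case_prod_beta Let_def set_reg_def)

declare exec.simps [simp del]

section \<open>Frame property of programs\<close>

primrec written_arrs :: "com \<Rightarrow> string set" where
  "written_arrs (x @: is ::= e) = {x}"
| "written_arrs (c ;; d) = written_arrs c \<union> written_arrs d"
| "written_arrs (FOR x FROM a BELOW b DO c) = written_arrs c"

primrec written_regs :: "com \<Rightarrow> string set" where
  "written_regs (x @: is ::= e) = {}"
| "written_regs (c ;; d) = written_regs c \<union> written_regs d"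
| "written_regs (FOR x FROM a BELOW b DO c) = insert x (written_regs c)"

text \<open>A relation between two states rather than a statement about one command: it composes
  along loops and describes an arbitrary state reached inside a loop. \<open>X\<close> and
  \<open>Y\<close> are meant to be the syntactic sets of written names, which are computed for
  concrete programs.\<close>

definition agree_off :: "string set \<Rightarrow> string set \<Rightarrow> state \<Rightarrow> state \<Rightarrow> bool" where
  "agree_off X Y s s' \<longleftrightarrow>
     (\<forall>x. x \<notin> X \<longrightarrow> arr s' x = arr s x) \<and> (\<forall>y. y \<notin> Y \<longrightarrow> reg s' y = reg s y)"

lemma agree_off_refl: "agree_off X Y s s"
  by (simp add: agree_off_def)

lemma agree_off_trans: "agree_off X Y s s' \<Longrightarrow> agree_off X Y s' s'' \<Longrightarrow> agree_off X Y s s''"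
  by (simp add: agree_off_def)

lemma agree_off_mono:
  "agree_off X Y s s' \<Longrightarrow> X \<subseteq> X' \<Longrightarrow> Y \<subseteq> Y' \<Longrightarrow> agree_off X' Y' s s'"
  by (auto simp: agree_off_def)

lemma agree_off_set_reg: "y \<in> Y \<Longrightarrow> agree_off X Y s (set_reg s y i)"
  by (auto simp: agree_off_def)

lemma agree_off_run: "agree_off (written_arrs c) (written_regs c) s (run c s)"
proof (induction c arbitrary: s)
  case (Assign x "is" e)
  show ?case by (simp add: agree_off_def run_Assign)
next
  case (Seq c d)
  show ?case
    unfolding run_Seq
    by (rule agree_off_trans[OF agree_off_mono[OF Seq.IH(1)] agree_off_mono[OF Seq.IH(2)]]) auto
next
  case (For x a b c)
  let ?A = "agree_off (written_arrs c) (insert x (written_regs c))"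
  have step: "?A s (run c (set_reg s x i))" for s i
    by (rule agree_off_trans[OF agree_off_set_reg agree_off_mono[OF For.IH]]) auto
  \<comment> \<open>The start state is arbitrary because each iteration begins where the previous
    one ended. Setting the loop variable is harmless, since it belongs to the exempt
    registers.\<close>
  have "?A s (fold (\<lambda>i s. run c (set_reg s x i)) is s)" for "is" s
  proof (induction "is" arbitrary: s)
    case (Cons i "is")
    from agree_off_trans[OF step Cons.IH] show ?case by simp
  qed (simp add: agree_off_refl)
  then show ?case by (simp add: run_For)
qed

lemma arr_run_frame: "x \<notin> written_arrs c \<Longrightarrow> arr (run c s) x = arr s x"
  and reg_run_frame: "y \<notin> written_regs c \<Longrightarrow> reg (run c s) y = reg s y"
  using agree_off_run[of c s] by (auto simp: agree_off_def)

text \<open>The invariant speaks about the arrays only; what happens to the registers and to the arrays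
  that the body does not write comes for free from the frame property.\<close>

lemma run_For_invariant:
  assumes "ival a s = lo" "ival b s = hi" "lo \<le> hi"
    and init: "I lo (arr s)"
    and step: "\<And>i s'. lo \<le> i \<Longrightarrow> i < hi \<Longrightarrow>
      agree_off (written_arrs c) (insert x (written_regs c)) s s' \<Longrightarrow> reg s' x = i \<Longrightarrow>
      I i (arr s') \<Longrightarrow> I (Suc i) (arr (run c s'))"
  shows "I hi (arr (run (FOR x FROM a BELOW b DO c) s))"
proof -
  let ?f = "\<lambda>i s. run c (set_reg s x i)"
  let ?A = "agree_off (written_arrs c) (insert x (written_regs c)) s"
  \<comment> \<open>Agreement with the start state is proved together with the invariant, since
    preservation is assumed only for states that agree with it.\<close>
  have "?A (fold ?f [lo..<i] s) \<and> I i (arr (fold ?f [lo..<i] s))" if "lo \<le> i" "i \<le> hi" for i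
    using that
  proof (induction i rule: dec_induct)
    case base
    show ?case by (simp add: init agree_off_refl)
  next
    case (step i)
    let ?s = "set_reg (fold ?f [lo..<i] s) x i"
    have A: "?A ?s"
      using step by (auto simp: agree_off_def)
    moreover have "agree_off (written_arrs c) (insert x (written_regs c)) ?s (run c ?s)"
      by (rule agree_off_mono[OF agree_off_run]) auto
    ultimately have "?A (run c ?s)" by (rule agree_off_trans)
    moreover have "I (Suc i) (arr (run c ?s))"
      \<comment> \<open>\<open>assms(5)\<close> is the preservation hypothesis, whose name
        \<open>step\<close> is shadowed here by the induction case.\<close>
      using step A by (intro assms(5)) auto
    ultimately show ?case using step by simp
  qed
  with assms show ?thesis by (simp add: run_For)
qed

text \<open>\<open>idx\<close> leaves the value of the loop variable open, which forces the same
  cell \<open>p\<close> in every iteration. \<open>val\<close> offers no information on the array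
  \<open>y\<close>, so the summands cannot depend on the running total and the loop amounts to a
  finite sum.\<close>

lemma arr_accumulate_loop:
  assumes "ival a s = lo" "ival b s = hi" "lo \<le> hi"
    and idx: "\<And>s'. \<lbrakk>\<And>y. y \<noteq> x \<Longrightarrow> reg s' y = reg s y\<rbrakk> \<Longrightarrow> map (\<lambda>a. ival a s') is = p"
    and val: "\<And>i s'. \<lbrakk>lo \<le> i; i < hi; \<And>y. y \<noteq> x \<Longrightarrow> reg s' y = reg s y; reg s' x = i;
       \<And>z. z \<noteq> y \<Longrightarrow> arr s' z = arr s z\<rbrakk> \<Longrightarrow> rval e s' = f i"
  shows "arr (run (FOR x FROM a BELOW b DO y @: is ::= y @: is +\<^sub>r e) s) =
    (arr s)(y := (arr s y)(p := arr s y p + (\<Sum>i=lo..<hi. f i)))"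
proof (rule run_For_invariant[where
      I = "\<lambda>i A. A = (arr s)(y := (arr s y)(p := arr s y p + (\<Sum>i=lo..<i. f i)))"])
  fix i s'
  assume *: "lo \<le> i" "i < hi" "reg s' x = i"
    "agree_off (written_arrs (y @: is ::= y @: is +\<^sub>r e))
      (insert x (written_regs (y @: is ::= y @: is +\<^sub>r e))) s s'"
    "arr s' = (arr s)(y := (arr s y)(p := arr s y p + (\<Sum>i=lo..<i. f i)))"
  have r: "\<And>y. y \<noteq> x \<Longrightarrow> reg s' y = reg s y"
    using * by (auto simp: agree_off_def)
  have "map (\<lambda>a. ival a s') is = p" using r by (rule idx)
  moreover have "rval e s' = f i" using * r by (intro val) auto
  ultimately show "arr (run (y @: is ::= y @: is +\<^sub>r e) s') =
      (arr s)(y := (arr s y)(p := arr s y p + (\<Sum>i=lo..<Suc i. f i)))"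
    using * by (simp add: run_Assign algebra_simps)
qed (use assms in simp_all)

text \<open>Injectivity of \<open>p\<close> keeps every written cell from being overwritten. In
  contrast to accumulation, \<open>e\<close> may read those cells of \<open>y\<close> that earlier
  iterations have not touched; the in-place update of \<open>h\<close> and the table
  \<open>T\<close>, which is built from its own next row, rely on this.\<close>

lemma arr_pointwise_loop:
  assumes "ival a s = lo" "ival b s = hi" "lo \<le> hi"
    and idx: "\<And>i s'. \<lbrakk>lo \<le> i; i < hi; \<And>y. y \<noteq> x \<Longrightarrow> reg s' y = reg s y; reg s' x = i\<rbrakk> \<Longrightarrow>
       map (\<lambda>a. ival a s') is = p i"
    and inj: "inj_on p {lo..<hi}"
    and val: "\<And>i s'. \<lbrakk>lo \<le> i; i < hi; \<And>y. y \<noteq> x \<Longrightarrow> reg s' y = reg s y; reg s' x = i;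
       \<And>z. z \<noteq> y \<Longrightarrow> arr s' z = arr s z; \<And>q. q \<notin> p ` {lo..<i} \<Longrightarrow> arr s' y q = arr s y q\<rbrakk> \<Longrightarrow> rval e s' = f i"
  shows "(\<forall>i\<in>{lo..<hi}. arr (run (FOR x FROM a BELOW b DO y @: is ::= e) s) y (p i) = f i) \<and>
    (\<forall>q. q \<notin> p ` {lo..<hi} \<longrightarrow>
      arr (run (FOR x FROM a BELOW b DO y @: is ::= e) s) y q = arr s y q)"
proof -
  let ?c = "y @: is ::= e"
  let ?I = "\<lambda>k A. (\<forall>i\<in>{lo..<k}. A y (p i) = f i) \<and> (\<forall>q. q \<notin> p ` {lo..<k} \<longrightarrow> A y q = arr s y q)"
  show ?thesis
  proof (rule run_For_invariant[where I = ?I])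
    fix k s'
    assume *: "lo \<le> k" "k < hi" "reg s' x = k"
      "agree_off (written_arrs ?c) (insert x (written_regs ?c)) s s'" "?I k (arr s')"
    have r: "\<And>y. y \<noteq> x \<Longrightarrow> reg s' y = reg s y"
      using * by (auto simp: agree_off_def)
    have new: "p k \<notin> p ` {lo..<k}"
    proof
      assume "p k \<in> p ` {lo..<k}"
      then obtain i where "i \<in> {lo..<k}" "p k = p i" by blast
      with inj_onD[OF inj, of k i] * show False by auto
    qed
    have i: "map (\<lambda>a. ival a s') is = p k" using * r by (intro idx) auto
    have v: "rval e s' = f k"
      using * r new by (intro val) (auto simp: agree_off_def)
    have A: "arr (run ?c s') y = (arr s' y)(p k := f k)"
      by (simp add: run_Assign i v)
    have S: "{lo..<Suc k} = insert k {lo..<k}" using * by auto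
    show "?I (Suc k) (arr (run ?c s'))"
      unfolding A S using * new by (auto simp: image_iff)
  qed (use assms in simp_all)
qed

section \<open>Operation count\<close>

text \<open>The bound is demanded from every state with these three sizes. Counters such as
  \<open>k\<close> may hold anything, so a loop bound that mentions them has to be estimated by the
  sizes alone.\<close>

definition cost_le :: "nat \<Rightarrow> nat \<Rightarrow> nat \<Rightarrow> com \<Rightarrow> nat \<Rightarrow> bool" where
  "cost_le n r l c t \<longleftrightarrow>
     (\<forall>s. reg s ''n'' = n \<and> reg s ''r'' = r \<and> reg s ''l'' = l \<longrightarrow> snd (exec c s) \<le> t)"

lemma cost_le_Assign: "cost_le n r l (x @: is ::= e) (1 + sum_list (map icost is) + rcost e)"
  by (simp add: cost_le_def exec.simps)

lemma cost_le_Seq: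
  assumes "cost_le n r l c t" "cost_le n r l d u" "{''n'', ''r'', ''l''} \<inter> written_regs c = {}"
  shows "cost_le n r l (c ;; d) (t + u)"
  using assms unfolding cost_le_def cost_Seq by (auto simp: reg_run_frame intro!: add_mono)

lemma cost_le_For:
  assumes c: "cost_le n r l c t"
    and w: "{''n'', ''r'', ''l''} \<inter> written_regs (FOR x FROM a BELOW b DO c) = {}"
    and N: "\<And>s. reg s ''n'' = n \<Longrightarrow> reg s ''r'' = r \<Longrightarrow> reg s ''l'' = l \<Longrightarrow>
      ival b s - ival a s \<le> N"
  shows "cost_le n r l (FOR x FROM a BELOW b DO c) (1 + icost a + icost b + N * (1 + t))"
  unfolding cost_le_def
proof (intro allI impI)
  fix s :: state
  let ?R = "\<lambda>s :: state. reg s ''n'' = n \<and> reg s ''r'' = r \<and> reg s ''l'' = l"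
  assume s: "?R s"
  let ?f = "\<lambda>i (s1, t1). let (s2, t2) = exec c (set_reg s1 x i) in (s2, t1 + 1 + t2)"
  \<comment> \<open>The body does not write the size registers, so every iteration starts from a
    state to which its bound \<open>t\<close> applies. The initial count \<open>u\<close> is
    arbitrary for the sake of the induction.\<close>
  have "snd (fold ?f is (s, u)) \<le> u + length is * (1 + t)" if "?R s" for "is" s u
    using that
  proof (induction "is" arbitrary: s u)
    case (Cons i "is")
    let ?s = "set_reg s x i"
    have "?R ?s" using Cons.prems w by auto
    then have "?R (run c ?s)" "snd (exec c ?s) \<le> t"
      using w c by (auto simp: reg_run_frame cost_le_def)
    then show ?case
      using Cons.IH[of "run c ?s" "u + 1 + snd (exec c ?s)"]
      by (simp add: case_prod_beta Let_def)
  qed simp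
  from this[OF s, of "[ival a s..<ival b s]" "1 + icost a + icost b"]
  have "snd (exec (FOR x FROM a BELOW b DO c) s) \<le>
      1 + icost a + icost b + (ival b s - ival a s) * (1 + t)"
    by (simp add: exec.simps set_reg_def)
  also have "\<dots> \<le> 1 + icost a + icost b + N * (1 + t)"
    using N[of s] s by (intro add_left_mono mult_right_mono) auto
  finally show "snd (exec (FOR x FROM a BELOW b DO c) s) \<le> 1 + icost a + icost b + N * (1 + t)" .
qed

text \<open>\<open>t\<close> is chosen before \<open>n\<close>, \<open>r\<close> and
  \<open>l\<close>, so it depends only on \<open>K\<close> and the program. The same order of
  quantifiers in \<open>linear_cost\<close> makes its constants independent of
  \<open>n\<close>.\<close>

definition const_cost :: "nat \<Rightarrow> com \<Rightarrow> bool" where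
  "const_cost K c \<longleftrightarrow> (\<exists>t. \<forall>n r l. r \<le> K \<longrightarrow> l \<le> K \<longrightarrow> cost_le n r l c t)"

definition linear_cost :: "nat \<Rightarrow> com \<Rightarrow> bool" where
  "linear_cost K c \<longleftrightarrow> (\<exists>t u. \<forall>n r l. r \<le> K \<longrightarrow> l \<le> K \<longrightarrow> cost_le n r l c (t + n * u))"

lemma const_cost_Assign: "const_cost K (x @: is ::= e)"
  unfolding const_cost_def using cost_le_Assign by blast

lemma const_cost_Seq:
  assumes "const_cost K c" "const_cost K d" "{''n'', ''r'', ''l''} \<inter> written_regs c = {}"
  shows "const_cost K (c ;; d)"
  using assms unfolding const_cost_def by (meson cost_le_Seq)

text \<open>The allowance is \<open>Suc K\<close> because the loops over the columns of
  \<open>G\<close>, and over the offsets \<open>t\<close> starting at 0, may make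
  \<open>l + 1\<close> passes.\<close>

lemma const_cost_For:
  assumes c: "const_cost K c"
    and w: "{''n'', ''r'', ''l''} \<inter> written_regs (FOR x FROM a BELOW b DO c) = {}"
    and N: "\<And>s. reg s ''r'' \<le> K \<Longrightarrow> reg s ''l'' \<le> K \<Longrightarrow> ival b s - ival a s \<le> Suc K"
  shows "const_cost K (FOR x FROM a BELOW b DO c)"
proof -
  obtain t where "\<forall>n r l. r \<le> K \<longrightarrow> l \<le> K \<longrightarrow> cost_le n r l c t"
    using c unfolding const_cost_def by blast
  then have "r \<le> K \<longrightarrow> l \<le> K \<longrightarrow>
      cost_le n r l (FOR x FROM a BELOW b DO c) (1 + icost a + icost b + Suc K * (1 + t))" for n r l
    using w N by (intro impI cost_le_For) auto
  then show ?thesis unfolding const_cost_def by blast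
qed

lemma linear_cost_const: "const_cost K c \<Longrightarrow> linear_cost K c"
  unfolding const_cost_def linear_cost_def by (metis add.right_neutral mult_0_right)

lemma linear_cost_Seq:
  assumes "linear_cost K c" "linear_cost K d" "{''n'', ''r'', ''l''} \<inter> written_regs c = {}"
  shows "linear_cost K (c ;; d)"
proof -
  obtain t u where c: "\<forall>n r l. r \<le> K \<longrightarrow> l \<le> K \<longrightarrow> cost_le n r l c (t + n * u)"
    using assms(1) unfolding linear_cost_def by blast
  obtain t' u' where d: "\<forall>n r l. r \<le> K \<longrightarrow> l \<le> K \<longrightarrow> cost_le n r l d (t' + n * u')"
    using assms(2) unfolding linear_cost_def by blast
  have "cost_le n r l (c ;; d) ((t + t') + n * (u + u'))" if "r \<le> K" "l \<le> K" for n r l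
  proof -
    have "(t + t') + n * (u + u') = (t + n * u) + (t' + n * u')" by (simp add: algebra_simps)
    then show ?thesis using c d assms(3) that by (simp only:) (intro cost_le_Seq; simp)
  qed
  then show ?thesis unfolding linear_cost_def by blast
qed

lemma linear_cost_For:
  assumes c: "const_cost K c"
    and w: "{''n'', ''r'', ''l''} \<inter> written_regs (FOR x FROM a BELOW b DO c) = {}"
    and N: "\<And>s. ival b s - ival a s \<le> reg s ''n''"
  shows "linear_cost K (FOR x FROM a BELOW b DO c)"
proof -
  obtain t where "\<forall>n r l. r \<le> K \<longrightarrow> l \<le> K \<longrightarrow> cost_le n r l c t"
    using c unfolding const_cost_def by blast
  then have "r \<le> K \<longrightarrow> l \<le> K \<longrightarrow>
      cost_le n r l (FOR x FROM a BELOW b DO c) ((1 + icost a + icost b) + n * (1 + t))" for n r l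
    using w N by (intro impI cost_le_For) auto
  then show ?thesis unfolding linear_cost_def by blast
qed

lemmas cost_rules = const_cost_Assign const_cost_Seq const_cost_For

lemma linear_cost_init: "linear_cost K init_prog"
  unfolding init_prog_def
  by (intro linear_cost_Seq linear_cost_For linear_cost_const cost_rules) auto

lemma linear_cost_table: "linear_cost K table_prog"
  unfolding table_prog_def
  \<comment> \<open>The first loop only fills row \<open>n\<close> of the tables and has constant
    cost; the second one runs over the remaining rows.\<close>
  by (rule linear_cost_Seq, rule linear_cost_const, (intro cost_rules; simp),
      rule linear_cost_For, (intro cost_rules; simp)) auto

lemma const_cost_inner: "const_cost K inner_prog"
  unfolding inner_prog_def by (intro cost_rules) auto

lemma const_cost_update: "const_cost K update_prog"
  unfolding update_prog_def by (intro cost_rules) auto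

lemma linear_cost_output: "linear_cost K output_prog"
  unfolding output_prog_def
  \<comment> \<open>The loop over the rows is linear, the correction of the last entry
    constant.\<close>
  by (rule linear_cost_Seq, rule linear_cost_For, (intro cost_rules; simp), simp, simp,
      rule linear_cost_const, (intro cost_rules; simp), simp)

lemma linear_cost_fast_apply_Qt: "linear_cost K fast_apply_Qt"
proof -
  have "written_regs inner_prog \<subseteq> {''j'', ''q'', ''t''}"
    "written_regs update_prog \<subseteq> {''j'', ''t''}"
    "written_regs init_prog \<subseteq> {''i'', ''j''}"
    "written_regs table_prog \<subseteq> {''i'', ''j'', ''q''}"
    by (auto simp: inner_prog_def update_prog_def init_prog_def table_prog_def)
  then show ?thesis
    unfolding fast_apply_Qt_def
    by (intro linear_cost_Seq linear_cost_For[OF const_cost_Seq] linear_cost_init linear_cost_table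
        const_cost_inner const_cost_update linear_cost_output) auto
qed

section \<open>Effect of the subprograms\<close>

text \<open>No subprogram writes its inputs, so this carries the input assumption to every
  intermediate state at which an array is read.\<close>

lemma input_state_agree_off:
  assumes "input_state n r l B U V tau b s" "agree_off X Y s s'"
    and "X \<inter> {''B'', ''U'', ''V'', ''tau'', ''b''} = {}" "Y \<inter> {''n'', ''r'', ''l''} = {}"
  shows "input_state n r l B U V tau b s'"
proof -
  have "arr s' ''B'' = arr s ''B''" "arr s' ''U'' = arr s ''U''" "arr s' ''V'' = arr s ''V''"
    "arr s' ''tau'' = arr s ''tau''" "arr s' ''b'' = arr s ''b''"
    "reg s' ''n'' = reg s ''n''" "reg s' ''r'' = reg s ''r''" "reg s' ''l'' = reg s ''l''"
    using assms(2-4) unfolding agree_off_def by blast+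
  with assms(1) show ?thesis by (simp add: input_state_def)
qed

lemma input_state_run:
  assumes "input_state n r l B U V tau b s"
    and "written_arrs c \<inter> {''B'', ''U'', ''V'', ''tau'', ''b''} = {}"
    and "written_regs c \<inter> {''n'', ''r'', ''l''} = {}"
  shows "input_state n r l B U V tau b (run c s)"
  using input_state_agree_off[OF assms(1) agree_off_run assms(2,3)] .

lemma run_init:
  assumes inp: "input_state n r l B U V tau b s"
  shows "i < n \<Longrightarrow> j < r \<Longrightarrow> arr (run init_prog s) ''O'' [i, j] = 0"
    and "i < n \<Longrightarrow> j \<le> l \<Longrightarrow> arr (run init_prog s) ''G'' [i, j] = 0"
    and "j < r \<Longrightarrow> arr (run init_prog s) ''h'' [j] = 0"
proof -
  let ?o = "FOR ''j'' FROM Ic 0 BELOW Iv ''r'' DO ''O'' @: [Iv ''i'', Iv ''j''] ::= Rc 0"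
  let ?g = "FOR ''j'' FROM Ic 0 BELOW Iv ''l'' +\<^sub>i Ic 1 DO ''G'' @: [Iv ''i'', Iv ''j''] ::= Rc 0"
  let ?og = "FOR ''i'' FROM Ic 0 BELOW Iv ''n'' DO (?o ;; ?g)"
  let ?h = "FOR ''j'' FROM Ic 0 BELOW Iv ''r'' DO ''h'' @: [Iv ''j''] ::= Rc 0"
  let ?I = "\<lambda>k A. \<forall>i<k. (\<forall>j<r. A ''O'' [i, j] = (0 :: real)) \<and> (\<forall>j\<le>l. A ''G'' [i, j] = 0)"
  have "?I n (arr (run ?og s))"
  proof (rule run_For_invariant[where I = ?I])
    fix i s'
    assume ag: "agree_off (written_arrs (?o ;; ?g)) (insert ''i'' (written_regs (?o ;; ?g))) s s'"
      and i: "reg s' ''i'' = i" and I: "?I i (arr s')"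
    have inp': "input_state n r l B U V tau b s'"
      by (rule input_state_agree_off[OF inp ag]) auto
    have inp'': "input_state n r l B U V tau b (run ?o s')"
      by (rule input_state_run[OF inp']) auto
    have o: "(\<forall>j\<in>{0..<r}. arr (run ?o s') ''O'' [i, j] = 0) \<and>
       (\<forall>q. q \<notin> (\<lambda>j. [i, j]) ` {0..<r} \<longrightarrow> arr (run ?o s') ''O'' q = arr s' ''O'' q)"
      by (rule arr_pointwise_loop) (use inp' i in \<open>auto simp: input_state_def inj_on_def\<close>)
    have i': "reg (run ?o s') ''i'' = i"
      by (simp add: reg_run_frame i)
    have g: "(\<forall>j\<in>{0..<Suc l}. arr (run ?g (run ?o s')) ''G'' [i, j] = 0) \<and>
       (\<forall>q. q \<notin> (\<lambda>j. [i, j]) ` {0..<Suc l} \<longrightarrow>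
          arr (run ?g (run ?o s')) ''G'' q = arr (run ?o s') ''G'' q)"
      by (rule arr_pointwise_loop) (use inp'' i' in \<open>auto simp: input_state_def inj_on_def\<close>)
    have "arr (run ?o s') ''G'' = arr s' ''G''" by (simp add: arr_run_frame)
    moreover have "arr (run ?g (run ?o s')) ''O'' = arr (run ?o s') ''O''"
      by (simp add: arr_run_frame)
    ultimately show "?I (Suc i) (arr (run (?o ;; ?g) s'))"
      using I o g by (auto simp: run_Seq less_Suc_eq image_iff)
  qed (use inp in \<open>auto simp: input_state_def\<close>)
  moreover have init: "run init_prog s = run ?h (run ?og s)"
    by (simp add: init_prog_def run_Seq)
  moreover have "arr (run ?h (run ?og s)) ''O'' = arr (run ?og s) ''O''"
    "arr (run ?h (run ?og s)) ''G'' = arr (run ?og s) ''G''"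
    by (simp_all add: arr_run_frame)
  ultimately show "i < n \<Longrightarrow> j < r \<Longrightarrow> arr (run init_prog s) ''O'' [i, j] = 0"
    and "i < n \<Longrightarrow> j \<le> l \<Longrightarrow> arr (run init_prog s) ''G'' [i, j] = 0"
    by simp_all
  have inp': "input_state n r l B U V tau b (run ?og s)"
    by (rule input_state_run[OF inp]) auto
  have "(\<forall>j\<in>{0..<r}. arr (run ?h (run ?og s)) ''h'' [j] = 0) \<and>
     (\<forall>q. q \<notin> (\<lambda>j. [j]) ` {0..<r} \<longrightarrow>
        arr (run ?h (run ?og s)) ''h'' q = arr (run ?og s) ''h'' q)"
    by (rule arr_pointwise_loop) (use inp' in \<open>auto simp: input_state_def inj_on_def\<close>)
  then show "j < r \<Longrightarrow> arr (run init_prog s) ''h'' [j] = 0"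
    by (simp add: init)
qed

text \<open>Row \<open>n\<close> holds empty sums, and each earlier row adds a single term to the
  row after it.\<close>

lemma run_table:
  assumes inp: "input_state n r l B U V tau b s"
  shows "k \<le> n \<Longrightarrow> j < r \<Longrightarrow>
      arr (run table_prog s) ''P'' [k, j] = (\<Sum>i=k..<n. U $$ (i, j) * b $ i)"
    and "k \<le> n \<Longrightarrow> j < r \<Longrightarrow> q < r \<Longrightarrow>
      arr (run table_prog s) ''T'' [k, j, q] = (\<Sum>i=k..<n. U $$ (i, j) * U $$ (i, q))"
proof -
  let ?pz = "''P'' @: [Iv ''n'', Iv ''j''] ::= Rc 0"
  let ?tz = "FOR ''q'' FROM Ic 0 BELOW Iv ''r'' DO ''T'' @: [Iv ''n'', Iv ''j'', Iv ''q''] ::= Rc 0"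
  let ?cz = "FOR ''j'' FROM Ic 0 BELOW Iv ''r'' DO (?pz ;; ?tz)"
  let ?p = "''P'' @: [Iv ''n'' -\<^sub>i Ic 1 -\<^sub>i Iv ''i'', Iv ''j''] ::=
            ''P'' @: [Iv ''n'' -\<^sub>i Iv ''i'', Iv ''j''] +\<^sub>r
            ''U'' @: [Iv ''n'' -\<^sub>i Ic 1 -\<^sub>i Iv ''i'', Iv ''j''] *\<^sub>r
            ''b'' @: [Iv ''n'' -\<^sub>i Ic 1 -\<^sub>i Iv ''i'']"
  let ?t = "FOR ''q'' FROM Ic 0 BELOW Iv ''r'' DO
            ''T'' @: [Iv ''n'' -\<^sub>i Ic 1 -\<^sub>i Iv ''i'', Iv ''j'', Iv ''q''] ::=
               ''T'' @: [Iv ''n'' -\<^sub>i Iv ''i'', Iv ''j'', Iv ''q''] +\<^sub>r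
               ''U'' @: [Iv ''n'' -\<^sub>i Ic 1 -\<^sub>i Iv ''i'', Iv ''j''] *\<^sub>r
               ''U'' @: [Iv ''n'' -\<^sub>i Ic 1 -\<^sub>i Iv ''i'', Iv ''q'']"
  let ?row = "FOR ''j'' FROM Ic 0 BELOW Iv ''r'' DO (?p ;; ?t)"
  let ?c = "FOR ''i'' FROM Ic 0 BELOW Iv ''n'' DO ?row"
  define ok where "ok A k j \<longleftrightarrow> A ''P'' [k, j] = (\<Sum>i=k..<n. U $$ (i, j) * b $ i) \<and>
      (\<forall>q<r. A ''T'' [k, j, q] = (\<Sum>i=k..<n. U $$ (i, j) * U $$ (i, q)))" for A k j
  have base: "\<forall>j<r. ok (arr (run ?cz s)) n j"
  proof (rule run_For_invariant[where I = "\<lambda>k A. \<forall>j<k. ok A n j"])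
    fix j s'
    assume ag: "agree_off (written_arrs (?pz ;; ?tz)) (insert ''j'' (written_regs (?pz ;; ?tz))) s s'"
      and j: "reg s' ''j'' = j" and I: "\<forall>i<j. ok (arr s') n i"
    have inp': "input_state n r l B U V tau b s'"
      by (rule input_state_agree_off[OF inp ag]) auto
    have inp'': "input_state n r l B U V tau b (run ?pz s')"
      by (rule input_state_run[OF inp']) auto
    have P: "arr (run ?pz s') = (arr s')(''P'' := (arr s' ''P'')([n, j] := 0))"
      using inp' j by (simp add: run_Assign input_state_def)
    have j': "reg (run ?pz s') ''j'' = j"
      by (simp add: reg_run_frame j)
    have T: "(\<forall>q\<in>{0..<r}. arr (run ?tz (run ?pz s')) ''T'' [n, j, q] = 0) \<and>
       (\<forall>q. q \<notin> (\<lambda>q. [n, j, q]) ` {0..<r} \<longrightarrow>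
          arr (run ?tz (run ?pz s')) ''T'' q = arr (run ?pz s') ''T'' q)"
      by (rule arr_pointwise_loop) (use inp'' j' in \<open>auto simp: input_state_def inj_on_def\<close>)
    have "arr (run ?tz (run ?pz s')) ''P'' = arr (run ?pz s') ''P''"
      by (simp add: arr_run_frame)
    then show "\<forall>i<Suc j. ok (arr (run (?pz ;; ?tz) s')) n i"
      using I P T by (auto simp: run_Seq less_Suc_eq image_iff ok_def)
  qed (use inp in \<open>auto simp: input_state_def\<close>)
  have inp0: "input_state n r l B U V tau b (run ?cz s)"
    by (rule input_state_run[OF inp]) auto
  \<comment> \<open>After \<open>i\<close> iterations the rows from \<open>n - i\<close> to
    \<open>n\<close> are filled; the additive form avoids truncated subtraction.\<close>
  let ?I = "\<lambda>i A. \<forall>k j. n \<le> k + i \<longrightarrow> k \<le> n \<longrightarrow> j < r \<longrightarrow> ok A k j"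
  have "?I n (arr (run ?c (run ?cz s)))"
  proof (rule run_For_invariant[where I = ?I])
    fix i s'
    assume "i < n"
      and ag: "agree_off (written_arrs ?row) (insert ''i'' (written_regs ?row)) (run ?cz s) s'"
      and i: "reg s' ''i'' = i" and I: "?I i (arr s')"
    define k where "k = n - 1 - i"
    have k: "k < n" "n - Suc i = k" "n - i = Suc k"
      using \<open>i < n\<close> by (auto simp: k_def)
    have S: "(\<Sum>i=k..<n. g i) = (\<Sum>i=Suc k..<n. g i) + g k" for g :: "nat \<Rightarrow> real"
      using k by (simp add: sum.atLeast_Suc_lessThan)
    have inp': "input_state n r l B U V tau b s'"
      by (rule input_state_agree_off[OF inp0 ag]) auto
    \<comment> \<open>The loop over \<open>j\<close> writes into the arrays that hold the finished
      rows, so the frame property does not protect them and they must be part of the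
      invariant.\<close>
    have "?I i (arr (run ?row s')) \<and> (\<forall>j<r. ok (arr (run ?row s')) k j)"
    proof (rule run_For_invariant[where I = "\<lambda>m A. ?I i A \<and> (\<forall>j<m. ok A k j)"])
      fix j s''
      assume "j < r"
        and ag': "agree_off (written_arrs (?p ;; ?t)) (insert ''j'' (written_regs (?p ;; ?t))) s' s''"
        and j: "reg s'' ''j'' = j" and I': "?I i (arr s'') \<and> (\<forall>m<j. ok (arr s'') k m)"
      have inp'': "input_state n r l B U V tau b s''"
        by (rule input_state_agree_off[OF inp' ag']) auto
      have i'': "reg s'' ''i'' = i"
        using ag' i by (simp add: agree_off_def)
      \<comment> \<open>Row \<open>Suc k\<close> is the most recently finished one, as
        \<open>Suc k + i = n\<close>.\<close>
      have prev: "ok (arr s'') (Suc k) j"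
        using I' k \<open>j < r\<close> \<open>i < n\<close> by auto
      define s3 where "s3 = run ?p s''"
      have P: "arr s3 =
          (arr s'')(''P'' := (arr s'' ''P'')([k, j] := (\<Sum>i=k..<n. U $$ (i, j) * b $ i)))"
        using inp'' j i'' prev k \<open>j < r\<close>
        by (simp add: s3_def run_Assign input_state_def ok_def S)
      have inp3: "input_state n r l B U V tau b s3"
        unfolding s3_def by (rule input_state_run[OF inp'']) auto
      have r3: "reg s3 ''j'' = j" "reg s3 ''i'' = i"
        by (simp_all add: s3_def reg_run_frame j i'')
      have T3: "\<forall>q<r. arr s3 ''T'' [Suc k, j, q] =
          (\<Sum>i=Suc k..<n. U $$ (i, j) * U $$ (i, q))"
        using prev by (simp add: P ok_def)
      have T: "(\<forall>q\<in>{0..<r}. arr (run ?t s3) ''T'' [k, j, q] =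
            (\<Sum>i=k..<n. U $$ (i, j) * U $$ (i, q))) \<and>
         (\<forall>q. q \<notin> (\<lambda>q. [k, j, q]) ` {0..<r} \<longrightarrow>
            arr (run ?t s3) ''T'' q = arr s3 ''T'' q)"
        by (rule arr_pointwise_loop)
          (use inp3 r3 T3 k \<open>j < r\<close> in
            \<open>auto simp: input_state_def inj_on_def image_iff S\<close>)
      have "arr (run ?t s3) ''P'' = arr s3 ''P''"
        by (simp add: arr_run_frame)
      moreover have "run (?p ;; ?t) s'' = run ?t s3"
        by (simp only: s3_def run_Seq)
      ultimately show "?I i (arr (run (?p ;; ?t) s'')) \<and> (\<forall>m<Suc j. ok (arr (run (?p ;; ?t) s'')) k m)"
        using I' P T k by (auto simp: less_Suc_eq image_iff ok_def)
    qed (use inp' I in \<open>auto simp: input_state_def\<close>)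
    \<comment> \<open>The set of finished rows grows by row \<open>k\<close> only.\<close>
    moreover have "n \<le> m + Suc i \<longleftrightarrow> m = k \<or> n \<le> m + i" for m
      using \<open>i < n\<close> by (auto simp: k_def)
    ultimately show "?I (Suc i) (arr (run ?row s'))" by auto
  qed (use inp0 base in \<open>auto simp: input_state_def\<close>)
  moreover have "run table_prog s = run ?c (run ?cz s)"
    by (simp add: table_prog_def run_Seq)
  ultimately show "k \<le> n \<Longrightarrow> j < r \<Longrightarrow>
      arr (run table_prog s) ''P'' [k, j] = (\<Sum>i=k..<n. U $$ (i, j) * b $ i)"
    and "k \<le> n \<Longrightarrow> j < r \<Longrightarrow> q < r \<Longrightarrow>
      arr (run table_prog s) ''T'' [k, j, q] = (\<Sum>i=k..<n. U $$ (i, j) * U $$ (i, q))"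
    by (auto simp: ok_def)
qed

text \<open>A pure evaluation of the program: the tables enter with whatever the arrays contain, and
  the link to the Householder vector is left to \<open>hh_vec_scalar_prod\<close>. \<open>x\<close>
  omits \<open>O\<close>, whose rows from \<open>k\<close> on are zero in the main loop.\<close>

lemma run_inner:
  assumes inp: "input_state n r l B U V tau b s"
    and k: "reg s ''k'' = k" "k < n"
  defines "w \<equiv> min l (n - 1 - k)"
    and "g \<equiv> \<lambda>t. \<Sum>j=0..<Suc l. arr s ''G'' [k + t, j]"
  defines "x \<equiv> \<lambda>t. b $ (k + t) + g t + (\<Sum>j=0..<r. U $$ (k + t, j) * arr s ''h'' [j])"
  shows "arr (run inner_prog s) ''z'' [] = x 0 +
    (\<Sum>j=0..<r. V $$ (k, j) * (arr s ''P'' [Suc k, j] +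
       (\<Sum>q=0..<r. arr s ''T'' [Suc k, j, q] * arr s ''h'' [q]) +
       (\<Sum>t=1..<Suc w. U $$ (k + t, j) * g t))) +
    (\<Sum>t=1..<Suc w. B $$ (k + t, k) * x t)"
proof -
  let ?w = "Imin (Iv ''l'') (Iv ''n'' -\<^sub>i Ic 1 -\<^sub>i Iv ''k'') +\<^sub>i Ic 1"
  let ?ga = "''g'' @: [Iv ''t''] ::= Rc 0"
  let ?gb = "FOR ''j'' FROM Ic 0 BELOW Iv ''l'' +\<^sub>i Ic 1 DO
          ''g'' @: [Iv ''t''] ::= ''g'' @: [Iv ''t''] +\<^sub>r
             ''G'' @: [Iv ''k'' +\<^sub>i Iv ''t'', Iv ''j'']"
  let ?xa = "''x'' @: [Iv ''t''] ::= ''b'' @: [Iv ''k'' +\<^sub>i Iv ''t''] +\<^sub>r ''g'' @: [Iv ''t'']"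
  let ?xb = "FOR ''j'' FROM Ic 0 BELOW Iv ''r'' DO
          ''x'' @: [Iv ''t''] ::= ''x'' @: [Iv ''t''] +\<^sub>r
             ''U'' @: [Iv ''k'' +\<^sub>i Iv ''t'', Iv ''j''] *\<^sub>r ''h'' @: [Iv ''j'']"
  let ?gx = "?ga ;; ?gb ;; ?xa ;; ?xb"
  let ?G = "FOR ''t'' FROM Ic 0 BELOW ?w DO ?gx"
  let ?za = "''z'' @: [] ::= ''x'' @: [Ic 0]"
  let ?aa = "''a'' @: [] ::= ''P'' @: [Iv ''k'' +\<^sub>i Ic 1, Iv ''j'']"
  let ?ab = "FOR ''q'' FROM Ic 0 BELOW Iv ''r'' DO
           ''a'' @: [] ::= ''a'' @: [] +\<^sub>r
              ''T'' @: [Iv ''k'' +\<^sub>i Ic 1, Iv ''j'', Iv ''q''] *\<^sub>r ''h'' @: [Iv ''q'']"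
  let ?ac = "FOR ''t'' FROM Ic 1 BELOW ?w DO
           ''a'' @: [] ::= ''a'' @: [] +\<^sub>r
              ''U'' @: [Iv ''k'' +\<^sub>i Iv ''t'', Iv ''j''] *\<^sub>r ''g'' @: [Iv ''t'']"
  let ?zb = "''z'' @: [] ::= ''z'' @: [] +\<^sub>r ''V'' @: [Iv ''k'', Iv ''j''] *\<^sub>r ''a'' @: []"
  let ?az = "?aa ;; ?ab ;; ?ac ;; ?zb"
  let ?A = "FOR ''j'' FROM Ic 0 BELOW Iv ''r'' DO ?az"
  let ?Z = "FOR ''t'' FROM Ic 1 BELOW ?w DO
       ''z'' @: [] ::= ''z'' @: [] +\<^sub>r
          ''B'' @: [Iv ''k'' +\<^sub>i Iv ''t'', Iv ''k''] *\<^sub>r ''x'' @: [Iv ''t'']"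
  \<comment> \<open>Every row \<open>k + t\<close> with \<open>t \<le> w\<close> exists, so the
    input arrays may be read there.\<close>
  have w: "k + w < n"
    using k by (auto simp: w_def)
  have GX: "\<forall>t<Suc w. arr (run ?G s) ''g'' [t] = g t \<and> arr (run ?G s) ''x'' [t] = x t"
  proof (rule run_For_invariant[where I = "\<lambda>m A. \<forall>t<m. A ''g'' [t] = g t \<and> A ''x'' [t] = x t"])
    fix t s'
    assume t: "t < Suc w"
      and ag: "agree_off (written_arrs ?gx) (insert ''t'' (written_regs ?gx)) s s'"
      and t': "reg s' ''t'' = t"
      and I: "\<forall>m<t. arr s' ''g'' [m] = g m \<and> arr s' ''x'' [m] = x m"
    define s1 where "s1 = run ?ga s'"
    define s2 where "s2 = run ?gb s1"
    define s3 where "s3 = run ?xa s2"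
    define s4 where "s4 = run ?xb s3"
    have kt: "k + t < n" using t w by simp
    have inp': "input_state n r l B U V tau b s'"
      by (rule input_state_agree_off[OF inp ag]) auto
    have inp1: "input_state n r l B U V tau b s1"
      unfolding s1_def by (rule input_state_run[OF inp']) auto
    have inp2: "input_state n r l B U V tau b s2"
      unfolding s2_def by (rule input_state_run[OF inp1]) auto
    have inp3: "input_state n r l B U V tau b s3"
      unfolding s3_def by (rule input_state_run[OF inp2]) auto
    have regs: "reg s1 ''t'' = t" "reg s1 ''k'' = k" "reg s2 ''t'' = t" "reg s2 ''k'' = k"
      "reg s3 ''t'' = t" "reg s3 ''k'' = k"
      using ag k t' by (simp_all add: s1_def s2_def s3_def reg_run_frame agree_off_def)
    have eq: "arr s' ''G'' = arr s ''G''" "arr s' ''h'' = arr s ''h''"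
      using ag by (simp_all add: agree_off_def)
    have A1: "arr s1 = (arr s')(''g'' := (arr s' ''g'')([t] := 0))"
      by (simp add: s1_def run_Assign t')
    have A2: "arr s2 = (arr s1)(''g'' := (arr s1 ''g'')([t] := arr s1 ''g'' [t] +
        (\<Sum>j=0..<Suc l. arr s ''G'' [k + t, j])))"
      unfolding s2_def
      by (rule arr_accumulate_loop) (use inp1 regs in \<open>auto simp: input_state_def A1 eq\<close>)
    have A3: "arr s3 = (arr s2)(''x'' := (arr s2 ''x'')([t] := b $ (k + t) + g t))"
      using inp2 kt regs by (simp add: s3_def run_Assign input_state_def A2 A1 g_def)
    have A4: "arr s4 = (arr s3)(''x'' := (arr s3 ''x'')([t] := arr s3 ''x'' [t] +
        (\<Sum>j=0..<r. U $$ (k + t, j) * arr s ''h'' [j])))"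
      unfolding s4_def
      by (rule arr_accumulate_loop)
        (use inp3 kt regs in \<open>auto simp: input_state_def A3 A2 A1 eq\<close>)
    have "run ?gx s' = s4"
      by (simp only: s4_def s3_def s2_def s1_def run_Seq)
    then show "\<forall>m<Suc t. arr (run ?gx s') ''g'' [m] = g m \<and> arr (run ?gx s') ''x'' [m] = x m"
      using I by (auto simp: A4 A3 A2 A1 less_Suc_eq g_def x_def)
  qed (use inp k in \<open>auto simp: input_state_def w_def\<close>)
  define s1 where "s1 = run ?za (run ?G s)"
  have inp1: "input_state n r l B U V tau b s1"
    unfolding s1_def by (intro input_state_run[OF input_state_run[OF inp]]) auto
  have k1: "reg s1 ''k'' = k"
    by (simp add: s1_def reg_run_frame k)
  have z1: "arr s1 ''z'' [] = x 0"
    using GX by (simp add: s1_def run_Assign)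
  have eq1: "arr s1 ''P'' = arr s ''P''" "arr s1 ''T'' = arr s ''T''" "arr s1 ''h'' = arr s ''h''"
    "\<forall>t<Suc w. arr s1 ''g'' [t] = g t" "\<forall>t<Suc w. arr s1 ''x'' [t] = x t"
    using GX by (simp_all add: s1_def arr_run_frame)
  let ?v = "\<lambda>j. arr s ''P'' [Suc k, j] +
       (\<Sum>q=0..<r. arr s ''T'' [Suc k, j, q] * arr s ''h'' [q]) +
       (\<Sum>t=1..<Suc w. U $$ (k + t, j) * g t)"
  \<comment> \<open>The loop adds the semiseparable contribution one column of \<open>V\<close> at a
    time; the array \<open>a\<close> collects the factor belonging to column
    \<open>j\<close>.\<close>
  have zA: "arr (run ?A s1) ''z'' [] = x 0 + (\<Sum>j=0..<r. V $$ (k, j) * ?v j)"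
  proof (rule run_For_invariant[where
        I = "\<lambda>m A. A ''z'' [] = x 0 + (\<Sum>j=0..<m. V $$ (k, j) * ?v j)"])
    fix j s'
    assume j: "j < r"
      and ag: "agree_off (written_arrs ?az) (insert ''j'' (written_regs ?az)) s1 s'"
      and j': "reg s' ''j'' = j"
      and I: "arr s' ''z'' [] = x 0 + (\<Sum>i=0..<j. V $$ (k, i) * ?v i)"
    define s2 where "s2 = run ?aa s'"
    define s3 where "s3 = run ?ab s2"
    define s4 where "s4 = run ?ac s3"
    have inp': "input_state n r l B U V tau b s'"
      by (rule input_state_agree_off[OF inp1 ag]) auto
    have inp2: "input_state n r l B U V tau b s2"
      unfolding s2_def by (rule input_state_run[OF inp']) auto
    have inp3: "input_state n r l B U V tau b s3"
      unfolding s3_def by (rule input_state_run[OF inp2]) auto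
    have inp4: "input_state n r l B U V tau b s4"
      unfolding s4_def by (rule input_state_run[OF inp3]) auto
    have regs: "reg s' ''k'' = k" "reg s2 ''j'' = j" "reg s2 ''k'' = k"
      "reg s3 ''j'' = j" "reg s3 ''k'' = k" "reg s4 ''j'' = j" "reg s4 ''k'' = k"
      using ag k1 j' by (simp_all add: s2_def s3_def s4_def reg_run_frame agree_off_def)
    have eq: "arr s' ''P'' = arr s ''P''" "arr s' ''T'' = arr s ''T''" "arr s' ''h'' = arr s ''h''"
      "arr s' ''g'' = arr s1 ''g''"
      using ag eq1 by (simp_all add: agree_off_def)
    have A2: "arr s2 = (arr s')(''a'' := (arr s' ''a'')([] := arr s ''P'' [Suc k, j]))"
      by (simp add: s2_def run_Assign j' regs eq)
    have A3: "arr s3 = (arr s2)(''a'' := (arr s2 ''a'')([] := arr s2 ''a'' [] +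
        (\<Sum>q=0..<r. arr s ''T'' [Suc k, j, q] * arr s ''h'' [q])))"
      unfolding s3_def
      by (rule arr_accumulate_loop) (use inp2 regs in \<open>auto simp: input_state_def A2 eq\<close>)
    have A4: "arr s4 = (arr s3)(''a'' := (arr s3 ''a'')([] := arr s3 ''a'' [] +
        (\<Sum>t=1..<Suc w. U $$ (k + t, j) * g t)))"
      unfolding s4_def
      by (rule arr_accumulate_loop)
        (use inp3 regs w j eq1 in \<open>auto simp: input_state_def A3 A2 eq w_def\<close>)
    have "arr (run ?zb s4) ''z'' [] = arr s' ''z'' [] + V $$ (k, j) * ?v j"
      using inp4 regs j k by (simp add: run_Assign input_state_def A4 A3 A2)
    moreover have "run ?az s' = run ?zb s4"
      by (simp only: s4_def s3_def s2_def run_Seq)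
    ultimately show "arr (run ?az s') ''z'' [] = x 0 + (\<Sum>i=0..<Suc j. V $$ (k, i) * ?v i)"
      using I by simp
  qed (use inp1 z1 in \<open>auto simp: input_state_def\<close>)
  define s2 where "s2 = run ?A s1"
  have inp2: "input_state n r l B U V tau b s2"
    unfolding s2_def by (rule input_state_run[OF inp1]) auto
  have k2: "reg s2 ''k'' = k"
    by (simp add: s2_def reg_run_frame k1)
  have eq2: "arr s2 ''x'' = arr s1 ''x''"
    by (simp add: s2_def arr_run_frame)
  have "arr (run ?Z s2) = (arr s2)(''z'' := (arr s2 ''z'')([] := arr s2 ''z'' [] +
      (\<Sum>t=1..<Suc w. B $$ (k + t, k) * x t)))"
    by (rule arr_accumulate_loop)
      (use inp2 k2 k w eq1 in \<open>auto simp: input_state_def eq2 w_def\<close>)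
  moreover have "run inner_prog s = run ?Z s2"
    by (simp only: inner_prog_def run_Seq s2_def s1_def)
  ultimately show ?thesis
    using zA[folded s2_def] by simp
qed

text \<open>Row \<open>k\<close> of \<open>O\<close> is written before \<open>h\<close> changes and
  therefore keeps the old \<open>h\<close>. The cells written in \<open>G\<close> are those with
  \<open>i = k + j\<close>; the value at \<open>j = 0\<close> comes from the unit entry of the
  Householder vector, the others from the band.\<close>

lemma run_update:
  assumes inp: "input_state n r l B U V tau b s"
    and k: "reg s ''k'' = k" "k < n"
  defines "d \<equiv> tau $ k * arr s ''z'' []"
  shows "j < r \<Longrightarrow> arr (run update_prog s) ''O'' [i, j] =
      (if i = k then U $$ (k, j) * arr s ''h'' [j] else arr s ''O'' [i, j])"
    and "j < r \<Longrightarrow> arr (run update_prog s) ''h'' [j] = arr s ''h'' [j] - d * V $$ (k, j)"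
    and "i < n \<Longrightarrow> j \<le> l \<Longrightarrow> arr (run update_prog s) ''G'' [i, j] =
      (if i = k + j then - d * (if j = 0 then 1 else B $$ (i, k)) else arr s ''G'' [i, j])"
proof -
  let ?w = "Imin (Iv ''l'') (Iv ''n'' -\<^sub>i Ic 1 -\<^sub>i Iv ''k'') +\<^sub>i Ic 1"
  let ?o = "FOR ''j'' FROM Ic 0 BELOW Iv ''r'' DO
       ''O'' @: [Iv ''k'', Iv ''j''] ::=
          ''U'' @: [Iv ''k'', Iv ''j''] *\<^sub>r ''h'' @: [Iv ''j'']"
  let ?h = "FOR ''j'' FROM Ic 0 BELOW Iv ''r'' DO
        ''h'' @: [Iv ''j''] ::= ''h'' @: [Iv ''j''] -\<^sub>r
           ''tau'' @: [Iv ''k''] *\<^sub>r ''z'' @: [] *\<^sub>r ''V'' @: [Iv ''k'', Iv ''j'']"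
  let ?ga = "''G'' @: [Iv ''k'', Ic 0] ::= Rneg (''tau'' @: [Iv ''k''] *\<^sub>r ''z'' @: [])"
  let ?gb = "FOR ''t'' FROM Ic 1 BELOW ?w DO
       ''G'' @: [Iv ''k'' +\<^sub>i Iv ''t'', Iv ''t''] ::=
          Rneg (''tau'' @: [Iv ''k''] *\<^sub>r ''z'' @: []) *\<^sub>r
          ''B'' @: [Iv ''k'' +\<^sub>i Iv ''t'', Iv ''k'']"
  define w where "w = min l (n - 1 - k)"
  have w: "k + w < n"
    using k by (auto simp: w_def)
  define s1 where "s1 = run ?o s"
  define s2 where "s2 = run ?h s1"
  define s3 where "s3 = run ?ga s2"
  define s4 where "s4 = run ?gb s3"
  have s4: "run update_prog s = s4"
    by (simp only: update_prog_def run_Seq s1_def s2_def s3_def s4_def)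
  have inp1: "input_state n r l B U V tau b s1"
    unfolding s1_def by (rule input_state_run[OF inp]) auto
  have inp2: "input_state n r l B U V tau b s2"
    unfolding s2_def by (rule input_state_run[OF inp1]) auto
  have inp3: "input_state n r l B U V tau b s3"
    unfolding s3_def by (rule input_state_run[OF inp2]) auto
  have regs: "reg s1 ''k'' = k" "reg s2 ''k'' = k" "reg s3 ''k'' = k"
    by (simp_all add: s1_def s2_def s3_def reg_run_frame k)
  have z: "arr s1 ''z'' = arr s ''z''" "arr s2 ''z'' = arr s ''z''" "arr s3 ''z'' = arr s ''z''"
    by (simp_all add: s1_def s2_def s3_def arr_run_frame)
  have "(\<forall>j\<in>{0..<r}. arr s1 ''O'' [k, j] = U $$ (k, j) * arr s ''h'' [j]) \<and>
     (\<forall>q. q \<notin> (\<lambda>j. [k, j]) ` {0..<r} \<longrightarrow> arr s1 ''O'' q = arr s ''O'' q)"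
    unfolding s1_def
    by (rule arr_pointwise_loop) (use inp k in \<open>auto simp: input_state_def inj_on_def\<close>)
  moreover have "arr s4 ''O'' = arr s1 ''O''"
    by (simp add: s4_def s3_def s2_def arr_run_frame)
  ultimately show "j < r \<Longrightarrow> arr (run update_prog s) ''O'' [i, j] =
      (if i = k then U $$ (k, j) * arr s ''h'' [j] else arr s ''O'' [i, j])"
    unfolding s4 by (auto simp: image_iff)
  have "(\<forall>j\<in>{0..<r}. arr s2 ''h'' [j] = arr s1 ''h'' [j] - d * V $$ (k, j)) \<and>
     (\<forall>q. q \<notin> (\<lambda>j. [j]) ` {0..<r} \<longrightarrow> arr s2 ''h'' q = arr s1 ''h'' q)"
    unfolding s2_def
    by (rule arr_pointwise_loop)
      (use inp1 regs k in \<open>auto simp: input_state_def inj_on_def d_def z image_iff\<close>)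
  moreover have "arr s4 ''h'' = arr s2 ''h''" "arr s1 ''h'' = arr s ''h''"
    by (simp_all add: s4_def s3_def s1_def arr_run_frame)
  ultimately show "j < r \<Longrightarrow>
      arr (run update_prog s) ''h'' [j] = arr s ''h'' [j] - d * V $$ (k, j)"
    unfolding s4 by auto
  have A3: "arr s3 ''G'' = (arr s2 ''G'')([k, 0] := - d)"
    using inp2 k by (simp add: s3_def run_Assign input_state_def regs z d_def)
  have G4: "(\<forall>t\<in>{1..<Suc w}. arr s4 ''G'' [k + t, t] = - d * B $$ (k + t, k)) \<and>
     (\<forall>q. q \<notin> (\<lambda>t. [k + t, t]) ` {1..<Suc w} \<longrightarrow> arr s4 ''G'' q = arr s3 ''G'' q)"
    unfolding s4_def
    by (rule arr_pointwise_loop)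
      (use inp3 regs k w in \<open>auto simp: input_state_def inj_on_def d_def z w_def\<close>)
  have G2: "arr s2 ''G'' = arr s ''G''"
    by (simp add: s2_def s1_def arr_run_frame)
  show "arr (run update_prog s) ''G'' [i, j] =
      (if i = k + j then - d * (if j = 0 then 1 else B $$ (i, k)) else arr s ''G'' [i, j])"
    if "i < n" "j \<le> l"
  proof (cases "i = k + j \<and> j \<noteq> 0")
    case True
    \<comment> \<open>The bounds \<open>j \<le> l\<close> and \<open>k + j = i < n\<close> together
      are exactly the range of the loop.\<close>
    then have "j \<in> {1..<Suc w}" using that by (auto simp: w_def)
    with True G4 show ?thesis unfolding s4 by auto
  next
    case False
    then have "[i, j] \<notin> (\<lambda>t. [k + t, t]) ` {1..<Suc w}" by auto
    with False G4 show ?thesis unfolding s4 by (auto simp: A3 G2)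
  qed
qed

lemma run_output:
  assumes inp: "input_state n r l B U V tau b s" and "i < n"
  shows "arr (run output_prog s) ''c'' [i] =
    b $ i + (\<Sum>j=0..<r. arr s ''O'' [i, j]) + (\<Sum>j=0..<Suc l. arr s ''G'' [i, j]) +
    (if Suc i = n then \<Sum>j=0..<r. U $$ (i, j) * arr s ''h'' [j] else 0)"
proof -
  let ?ca = "''c'' @: [Iv ''i''] ::= ''b'' @: [Iv ''i'']"
  let ?cb = "FOR ''j'' FROM Ic 0 BELOW Iv ''r'' DO
          ''c'' @: [Iv ''i''] ::= ''c'' @: [Iv ''i''] +\<^sub>r ''O'' @: [Iv ''i'', Iv ''j'']"
  let ?cc = "FOR ''j'' FROM Ic 0 BELOW Iv ''l'' +\<^sub>i Ic 1 DO
          ''c'' @: [Iv ''i''] ::= ''c'' @: [Iv ''i''] +\<^sub>r ''G'' @: [Iv ''i'', Iv ''j'']"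
  let ?row = "?ca ;; ?cb ;; ?cc"
  let ?c = "FOR ''i'' FROM Ic 0 BELOW Iv ''n'' DO ?row"
  let ?d = "FOR ''j'' FROM Ic 0 BELOW Iv ''r'' DO
       ''c'' @: [Iv ''n'' -\<^sub>i Ic 1] ::= ''c'' @: [Iv ''n'' -\<^sub>i Ic 1] +\<^sub>r
          ''U'' @: [Iv ''n'' -\<^sub>i Ic 1, Iv ''j''] *\<^sub>r ''h'' @: [Iv ''j'']"
  let ?v = "\<lambda>i. b $ i + (\<Sum>j=0..<r. arr s ''O'' [i, j]) + (\<Sum>j=0..<Suc l. arr s ''G'' [i, j])"
  define s1 where "s1 = run ?c s"
  have c: "\<forall>i<n. arr s1 ''c'' [i] = ?v i"
    unfolding s1_def
  proof (rule run_For_invariant[where I = "\<lambda>m A. \<forall>i<m. A ''c'' [i] = ?v i"])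
    fix i s'
    assume i: "i < n"
      and ag: "agree_off (written_arrs ?row) (insert ''i'' (written_regs ?row)) s s'"
      and i': "reg s' ''i'' = i"
      and I: "\<forall>m<i. arr s' ''c'' [m] = ?v m"
    define s2 where "s2 = run ?ca s'"
    define s3 where "s3 = run ?cb s2"
    define s4 where "s4 = run ?cc s3"
    have inp': "input_state n r l B U V tau b s'"
      by (rule input_state_agree_off[OF inp ag]) auto
    have inp2: "input_state n r l B U V tau b s2"
      unfolding s2_def by (rule input_state_run[OF inp']) auto
    have inp3: "input_state n r l B U V tau b s3"
      unfolding s3_def by (rule input_state_run[OF inp2]) auto
    have regs: "reg s2 ''i'' = i" "reg s3 ''i'' = i"
      using i' by (simp_all add: s2_def s3_def reg_run_frame)
    have eq: "arr s' ''O'' = arr s ''O''" "arr s' ''G'' = arr s ''G''"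
      using ag by (simp_all add: agree_off_def)
    have A2: "arr s2 = (arr s')(''c'' := (arr s' ''c'')([i] := b $ i))"
      using inp' i i' by (simp add: s2_def run_Assign input_state_def)
    have A3: "arr s3 = (arr s2)(''c'' := (arr s2 ''c'')([i] := arr s2 ''c'' [i] +
        (\<Sum>j=0..<r. arr s ''O'' [i, j])))"
      unfolding s3_def
      by (rule arr_accumulate_loop) (use inp2 regs in \<open>auto simp: input_state_def A2 eq\<close>)
    have A4: "arr s4 = (arr s3)(''c'' := (arr s3 ''c'')([i] := arr s3 ''c'' [i] +
        (\<Sum>j=0..<Suc l. arr s ''G'' [i, j])))"
      unfolding s4_def
      by (rule arr_accumulate_loop) (use inp3 regs in \<open>auto simp: input_state_def A3 A2 eq\<close>)
    have "run ?row s' = s4"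
      by (simp only: s4_def s3_def s2_def run_Seq)
    then show "\<forall>m<Suc i. arr (run ?row s') ''c'' [m] = ?v m"
      using I by (auto simp: A4 A3 A2 less_Suc_eq)
  qed (use inp in \<open>auto simp: input_state_def\<close>)
  have inp1: "input_state n r l B U V tau b s1"
    unfolding s1_def by (rule input_state_run[OF inp]) auto
  have h1: "arr s1 ''h'' = arr s ''h''"
    by (simp add: s1_def arr_run_frame)
  \<comment> \<open>From \<open>i < n\<close> the index \<open>n - 1\<close> is a genuine last row
    and not a truncated difference.\<close>
  have "arr (run ?d s1) = (arr s1)(''c'' := (arr s1 ''c'')([n - 1] := arr s1 ''c'' [n - 1] +
      (\<Sum>j=0..<r. U $$ (n - 1, j) * arr s ''h'' [j])))"
    by (rule arr_accumulate_loop) (use inp1 \<open>i < n\<close> in \<open>auto simp: input_state_def h1\<close>)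
  moreover have "run output_prog s = run ?d s1"
    by (simp only: output_prog_def run_Seq s1_def)
  ultimately show ?thesis
    using c \<open>i < n\<close> by auto
qed

section \<open>Correctness\<close>

lemma reflector_carrier [simp]: "reflector n t y \<in> carrier_mat n n"
  by (rule carrier_matI) (simp_all add: reflector_def)

lemma transpose_reflector: "transpose_mat (reflector n t y) = reflector n t y"
  by (rule eq_matI) (auto simp: reflector_def)

lemma reflector_mult_vec:
  assumes "x \<in> carrier_vec n" "y \<in> carrier_vec n" "i < n"
  shows "(reflector n t y *\<^sub>v x) $ i = x $ i - t * (y \<bullet> x) * y $ i"
proof -
  have "(reflector n t y *\<^sub>v x) $ i =
      (\<Sum>j=0..<n. ((if i = j then 1 else 0) - t * (y $ i * y $ j)) * x $ j)"
    using assms by (auto simp: reflector_def scalar_prod_def intro!: sum.cong)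
  also have "\<dots> = (\<Sum>j=0..<n. if i = j then x $ j else 0) - (\<Sum>j=0..<n. t * y $ i * (y $ j * x $ j))"
    unfolding sum_subtractf[symmetric] by (intro sum.cong) (auto simp: algebra_simps)
  also have "\<dots> = x $ i - t * (y \<bullet> x) * y $ i"
    using assms by (simp add: scalar_prod_def sum_distrib_left[symmetric])
  finally show ?thesis .
qed

lemma hh_vec_carrier [simp]: "hh_vec n F k \<in> carrier_vec n"
  by (simp add: hh_vec_def)

abbreviation apply_reflectors :: "nat \<Rightarrow> real mat \<Rightarrow> real vec \<Rightarrow> nat list \<Rightarrow> real vec \<Rightarrow> real vec" where
  "apply_reflectors n F tau \<equiv> fold (\<lambda>k x. reflector n (tau $ k) (hh_vec n F k) *\<^sub>v x)"

lemma apply_reflectors_carrier: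
  "x \<in> carrier_vec n \<Longrightarrow> apply_reflectors n F tau ks x \<in> carrier_vec n"
  by (induction ks arbitrary: x) (auto intro: mult_mat_vec_carrier[OF reflector_carrier])

text \<open>Transposition reverses the product and fixes each symmetric factor, so the leftmost
  reflector acts first. This is the order of the main loop.\<close>

lemma transpose_hh_Q_mult_vec:
  assumes "b \<in> carrier_vec n"
  shows "transpose_mat (hh_Q n F tau) *\<^sub>v b = apply_reflectors n F tau [0..<n - 1] b"
proof -
  let ?H = "\<lambda>k. reflector n (tau $ k) (hh_vec n F k)"
  let ?M = "\<lambda>ks. foldr (\<lambda>k M. ?H k * M) ks (1\<^sub>m n)"
  have M: "?M ks \<in> carrier_mat n n" for ks
    by (induction ks) (auto intro: mult_carrier_mat[OF reflector_carrier])
  have "transpose_mat (?M ks) *\<^sub>v b = apply_reflectors n F tau ks b" if "b \<in> carrier_vec n" for ks b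
    using that
  proof (induction ks arbitrary: b)
    case (Cons k ks)
    have "transpose_mat (?M (k # ks)) *\<^sub>v b = transpose_mat (?M ks) *\<^sub>v (?H k *\<^sub>v b)"
      using M[of ks] Cons.prems
      by (simp add: transpose_mult[OF reflector_carrier] transpose_reflector
          assoc_mult_mat_vec[OF _ reflector_carrier])
    also have "\<dots> = apply_reflectors n F tau ks (?H k *\<^sub>v b)"
      using Cons.prems by (intro Cons.IH) (auto intro: mult_mat_vec_carrier[OF reflector_carrier])
    finally show ?case by simp
  qed simp
  with assms show ?thesis by (simp add: hh_Q_def)
qed

section \<open>Structure of the Householder vectors and their inner products\<close>

lemma bps_repr_lower_entry:
  assumes "bps_repr n r p l m F B U V W S" "k < i" "i < n"
  shows "F $$ (i, k) = B $$ (i, k) + (\<Sum>j=0..<r. U $$ (i, j) * V $$ (k, j))"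
  \<comment> \<open>Below the diagonal the strictly upper summand vanishes, so the tail of a
    Householder vector is a band column plus a combination of the columns of
    \<open>U\<close>.\<close>
  using assms
  by (auto simp: bps_repr_def band_mats_def strict_tril_def strict_triu_def scalar_prod_def
      intro!: sum.cong)

lemma bps_repr_band_zero:
  assumes "bps_repr n r p l m F B U V W S" "k + l < i" "i < n"
  shows "B $$ (i, k) = 0"
  using assms by (simp add: bps_repr_def band_mats_def)

text \<open>Replaces a sum over all remaining rows by one with at most \<open>l\<close> terms,
  indexed by the offset from \<open>k\<close> as in the program.\<close>

lemma sum_band:
  fixes f :: "nat \<Rightarrow> real"
  assumes "k < n" and "\<And>i. k + l < i \<Longrightarrow> i < n \<Longrightarrow> f i = 0"
  shows "(\<Sum>i=Suc k..<n. f i) = (\<Sum>t=1..<Suc (min l (n - 1 - k)). f (k + t))"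
proof -
  have "(\<Sum>i=Suc k..<n. f i) = (\<Sum>i=1 + k..<Suc (min l (n - 1 - k)) + k. f i)"
    by (rule sum.mono_neutral_right) (use assms in auto)
  also have "\<dots> = (\<Sum>t=1..<Suc (min l (n - 1 - k)). f (t + k))"
    by (rule sum.shift_bounds_nat_ivl)
  finally show ?thesis by (simp add: add.commute)
qed

text \<open>Splits the Householder vector into its unit, band and semiseparable parts. In the last
  one the form of \<open>x\<close> is inserted, and interchanging sums isolates suffix sums over the
  rows of \<open>U\<close> that do not involve \<open>h\<close>; these are the table entries.
  \<open>h\<close> and \<open>g\<close> are arbitrary functions, so no program state occurs.\<close>

lemma hh_vec_scalar_prod:
  assumes repr: "bps_repr n r p l m F B U V W S"
    and k: "k < n" and x: "x \<in> carrier_vec n"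
    and xi: "\<And>i. k < i \<Longrightarrow> i < n \<Longrightarrow> x $ i = b $ i + (\<Sum>j=0..<r. U $$ (i, j) * h j) + g (i - k)"
    and g: "\<And>t. l < t \<Longrightarrow> k + t < n \<Longrightarrow> g t = 0"
  defines "w \<equiv> min l (n - 1 - k)"
  shows "hh_vec n F k \<bullet> x = x $ k +
    (\<Sum>j=0..<r. V $$ (k, j) * ((\<Sum>i=Suc k..<n. U $$ (i, j) * b $ i) +
       (\<Sum>q=0..<r. (\<Sum>i=Suc k..<n. U $$ (i, j) * U $$ (i, q)) * h q) +
       (\<Sum>t=1..<Suc w. U $$ (k + t, j) * g t))) +
    (\<Sum>t=1..<Suc w. B $$ (k + t, k) * x $ (k + t))"
proof -
  let ?y = "hh_vec n F k"
  have "?y \<bullet> x = (\<Sum>i=0..<n. ?y $ i * x $ i)"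
    using x by (simp add: scalar_prod_def)
  also have "\<dots> = (\<Sum>i=k..<n. ?y $ i * x $ i)"
    by (rule sum.mono_neutral_right) (auto simp: hh_vec_def)
  also have "\<dots> = x $ k + (\<Sum>i=Suc k..<n. F $$ (i, k) * x $ i)"
    using k by (simp add: sum.atLeast_Suc_lessThan hh_vec_def)
  also have "(\<Sum>i=Suc k..<n. F $$ (i, k) * x $ i) =
      (\<Sum>i=Suc k..<n. B $$ (i, k) * x $ i) +
      (\<Sum>i=Suc k..<n. \<Sum>j=0..<r. V $$ (k, j) * (U $$ (i, j) * x $ i))"
    unfolding sum.distrib[symmetric]
    by (intro sum.cong)
      (auto simp: bps_repr_lower_entry[OF repr] algebra_simps sum_distrib_left)
  also have "(\<Sum>i=Suc k..<n. B $$ (i, k) * x $ i) = (\<Sum>t=1..<Suc w. B $$ (k + t, k) * x $ (k + t))"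
    unfolding w_def by (rule sum_band) (use k bps_repr_band_zero[OF repr] in auto)
  \<comment> \<open>Summing over rows first lets \<open>V\<close> factor out, leaving inner products
    of \<open>x\<close> with tails of the columns of \<open>U\<close>.\<close>
  also have "(\<Sum>i=Suc k..<n. \<Sum>j=0..<r. V $$ (k, j) * (U $$ (i, j) * x $ i)) =
      (\<Sum>j=0..<r. V $$ (k, j) * (\<Sum>i=Suc k..<n. U $$ (i, j) * x $ i))"
    by (subst sum.swap) (simp add: sum_distrib_left)
  also have "\<dots> = (\<Sum>j=0..<r. V $$ (k, j) * ((\<Sum>i=Suc k..<n. U $$ (i, j) * b $ i) +
       (\<Sum>q=0..<r. (\<Sum>i=Suc k..<n. U $$ (i, j) * U $$ (i, q)) * h q) +
       (\<Sum>t=1..<Suc w. U $$ (k + t, j) * g t)))"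
  proof (intro sum.cong refl arg_cong2[where f = "(*)"])
    fix j
    have "(\<Sum>i=Suc k..<n. U $$ (i, j) * x $ i) =
        (\<Sum>i=Suc k..<n. U $$ (i, j) * b $ i) +
        (\<Sum>i=Suc k..<n. \<Sum>q=0..<r. U $$ (i, j) * U $$ (i, q) * h q) +
        (\<Sum>i=Suc k..<n. U $$ (i, j) * g (i - k))"
      unfolding sum.distrib[symmetric]
      by (intro sum.cong) (auto simp: xi algebra_simps sum_distrib_left)
    also have "(\<Sum>i=Suc k..<n. \<Sum>q=0..<r. U $$ (i, j) * U $$ (i, q) * h q) =
        (\<Sum>q=0..<r. (\<Sum>i=Suc k..<n. U $$ (i, j) * U $$ (i, q)) * h q)"
      by (subst sum.swap) (simp add: sum_distrib_right)
    \<comment> \<open>\<open>g\<close> vanishes beyond offset \<open>l\<close>, so this sum is cut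
      down in the same way as the band sum.\<close>
    also have "(\<Sum>i=Suc k..<n. U $$ (i, j) * g (i - k)) =
        (\<Sum>t=1..<Suc w. U $$ (k + t, j) * g (k + t - k))"
      unfolding w_def by (rule sum_band) (use k g in auto)
    finally show "(\<Sum>i=Suc k..<n. U $$ (i, j) * x $ i) =
        (\<Sum>i=Suc k..<n. U $$ (i, j) * b $ i) +
        (\<Sum>q=0..<r. (\<Sum>i=Suc k..<n. U $$ (i, j) * U $$ (i, q)) * h q) +
        (\<Sum>t=1..<Suc w. U $$ (k + t, j) * g t)"
      by simp
  qed
  finally show ?thesis by simp
qed

section \<open>Invariant of the main loop\<close>

definition implicit_entry ::
  "nat \<Rightarrow> nat \<Rightarrow> real mat \<Rightarrow> real vec \<Rightarrow> nat \<Rightarrow> (string \<Rightarrow> nat list \<Rightarrow> real) \<Rightarrow> nat \<Rightarrow> real" where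
  "implicit_entry r l U b k A i =
     b $ i + (if k \<le> i then \<Sum>j=0..<r. U $$ (i, j) * A ''h'' [j] else 0) +
     (\<Sum>j=0..<r. A ''O'' [i, j]) + (\<Sum>j=0..<Suc l. A ''G'' [i, j])"

text \<open>It depends on the arrays only, as \<open>run_For_invariant\<close> requires. The zero
  patterns record what has been written so far: an iteration \<open>k'\<close> touches row
  \<open>k'\<close> of \<open>O\<close> and the cells \<open>[k' + j, j]\<close> of
  \<open>G\<close>.\<close>

definition loop_inv ::
  "nat \<Rightarrow> nat \<Rightarrow> nat \<Rightarrow> real mat \<Rightarrow> real vec \<Rightarrow> real mat \<Rightarrow> real vec \<Rightarrow> nat \<Rightarrow>
   (string \<Rightarrow> nat list \<Rightarrow> real) \<Rightarrow> bool" where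
  "loop_inv n r l U b F tau k A \<longleftrightarrow>
     (\<forall>i j. k \<le> i \<longrightarrow> i < n \<longrightarrow> j < r \<longrightarrow> A ''O'' [i, j] = 0) \<and>
     (\<forall>i j. k + j \<le> i \<longrightarrow> i < n \<longrightarrow> j \<le> l \<longrightarrow> A ''G'' [i, j] = 0) \<and>
     (\<forall>i<n. implicit_entry r l U b k A i = apply_reflectors n F tau [0..<k] b $ i)"

text \<open>First \<open>z\<close> is identified with the inner product of the Householder vector
  \<open>y\<close> and the current vector \<open>x\<close>; then the update is shown to subtract
  \<open>d * y $ i\<close> from each implicit entry, separately above, at and below row
  \<open>k\<close>.\<close>

lemma loop_inv_step:
  assumes inp: "input_state n r l B U V tau b s"
    and repr: "bps_repr n r p l m F B U V W S"
    and b: "b \<in> carrier_vec n"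
    and k: "reg s ''k'' = k" "k < n"
    and P: "\<And>j. j < r \<Longrightarrow> arr s ''P'' [Suc k, j] = (\<Sum>i=Suc k..<n. U $$ (i, j) * b $ i)"
    and T: "\<And>j q. j < r \<Longrightarrow> q < r \<Longrightarrow>
      arr s ''T'' [Suc k, j, q] = (\<Sum>i=Suc k..<n. U $$ (i, j) * U $$ (i, q))"
    and inv: "loop_inv n r l U b F tau k (arr s)"
  shows "loop_inv n r l U b F tau (Suc k) (arr (run (inner_prog ;; update_prog) s))"
proof -
  define x where "x = apply_reflectors n F tau [0..<k] b"
  define y where "y = hh_vec n F k"
  define s1 where "s1 = run inner_prog s"
  define A where "A = arr s"
  define A' where "A' = arr (run update_prog s1)"
  define g where "g t = (\<Sum>j=0..<Suc l. A ''G'' [k + t, j])" for t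
  have x: "x \<in> carrier_vec n"
    unfolding x_def using b by (rule apply_reflectors_carrier)
  have O0: "A ''O'' [i, j] = 0" if "k \<le> i" "i < n" "j < r" for i j
    using inv that by (simp add: loop_inv_def A_def)
  have G0: "A ''G'' [i, j] = 0" if "k + j \<le> i" "i < n" "j \<le> l" for i j
    using inv that by (simp add: loop_inv_def A_def)
  have ent: "implicit_entry r l U b k A i = x $ i" if "i < n" for i
    using inv that by (simp add: loop_inv_def A_def x_def)
  have xi: "x $ i = b $ i + (\<Sum>j=0..<r. U $$ (i, j) * A ''h'' [j]) + g (i - k)"
    if "k \<le> i" "i < n" for i
    using ent[of i] that by (simp add: implicit_entry_def O0 g_def)
  \<comment> \<open>For \<open>t > l\<close> every column \<open>j \<le> l\<close> satisfies
    \<open>k + j \<le> k + t\<close>, so the whole row of \<open>G\<close> is still zero.\<close>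
  have g0: "g t = 0" if "l < t" "k + t < n" for t
    unfolding g_def using that by (intro sum.neutral) (auto intro: G0)
  have xkt: "b $ (k + t) + g t + (\<Sum>j=0..<r. U $$ (k + t, j) * A ''h'' [j]) = x $ (k + t)"
    if "k + t < n" for t
    using xi[of "k + t"] that by simp
  let ?w = "min l (n - 1 - k)"
  have z: "arr s1 ''z'' [] = y \<bullet> x"
  proof -
    have "arr s1 ''z'' [] =
      b $ (k + 0) + g 0 + (\<Sum>j=0..<r. U $$ (k + 0, j) * A ''h'' [j]) +
      (\<Sum>j=0..<r. V $$ (k, j) * (A ''P'' [Suc k, j] +
         (\<Sum>q=0..<r. A ''T'' [Suc k, j, q] * A ''h'' [q]) +
         (\<Sum>t=1..<Suc ?w. U $$ (k + t, j) * g t))) +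
      (\<Sum>t=1..<Suc ?w. B $$ (k + t, k) *
         (b $ (k + t) + g t + (\<Sum>j=0..<r. U $$ (k + t, j) * A ''h'' [j])))"
      unfolding s1_def g_def A_def by (rule run_inner[OF inp k])
    also have "\<dots> = x $ k +
      (\<Sum>j=0..<r. V $$ (k, j) * ((\<Sum>i=Suc k..<n. U $$ (i, j) * b $ i) +
         (\<Sum>q=0..<r. (\<Sum>i=Suc k..<n. U $$ (i, j) * U $$ (i, q)) * A ''h'' [q]) +
         (\<Sum>t=1..<Suc ?w. U $$ (k + t, j) * g t))) +
      (\<Sum>t=1..<Suc ?w. B $$ (k + t, k) * x $ (k + t))"
    \<comment> \<open>Both sides have the same shape; it remains to match table entries with suffix
      sums and explicit rows with entries of \<open>x\<close>.\<close>
    proof (intro arg_cong2[where f = "(+)"] sum.cong refl arg_cong2[where f = "(*)"])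
      show "b $ (k + 0) + g 0 + (\<Sum>j=0..<r. U $$ (k + 0, j) * A ''h'' [j]) = x $ k"
        using xkt[of 0] k by simp
    qed (use P T xkt k in \<open>auto simp: A_def\<close>)
    also have "\<dots> = y \<bullet> x"
      unfolding y_def using xi g0 by (intro hh_vec_scalar_prod[OF repr k(2) x, symmetric]) auto
    finally show ?thesis .
  qed
  have inp1: "input_state n r l B U V tau b s1"
    unfolding s1_def by (rule input_state_run[OF inp]) (auto simp: inner_prog_def)
  have k1: "reg s1 ''k'' = k"
    by (simp add: s1_def reg_run_frame inner_prog_def k)
  have eq: "arr s1 ''O'' = A ''O''" "arr s1 ''G'' = A ''G''" "arr s1 ''h'' = A ''h''"
    by (simp_all add: s1_def A_def arr_run_frame inner_prog_def)
  define d where "d = tau $ k * (y \<bullet> x)"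
  note upd = run_update[OF inp1 k1 k(2), folded A'_def, unfolded eq z, folded d_def]
  have "implicit_entry r l U b (Suc k) A' i = x $ i - d * y $ i" if i: "i < n" for i
  proof -
    \<comment> \<open>Row \<open>i\<close> changes at most in column \<open>i - k\<close>, where the
      old entry is zero. The guard \<open>k \<le> i\<close> is essential because
      \<open>i - k\<close> is 0 for \<open>i < k\<close>.\<close>
    have G': "(\<Sum>j=0..<Suc l. A' ''G'' [i, j]) = (\<Sum>j=0..<Suc l. A ''G'' [i, j]) -
        (if k \<le> i \<and> i \<le> k + l then d * (if i = k then 1 else B $$ (i, k)) else 0)"
    proof -
      have "(\<Sum>j=0..<Suc l. A' ''G'' [i, j]) =
          (\<Sum>j=0..<Suc l. A ''G'' [i, j] -
            (if j = i - k then if k \<le> i then d * (if i = k then 1 else B $$ (i, k)) else 0 else 0))"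
        using i by (intro sum.cong) (auto simp: upd G0)
      also have "\<dots> = (\<Sum>j=0..<Suc l. A ''G'' [i, j]) -
        (if k \<le> i \<and> i \<le> k + l then d * (if i = k then 1 else B $$ (i, k)) else 0)"
        by (auto simp: sum_subtractf)
      finally show ?thesis .
    qed
    consider "i < k" | "i = k" | "k < i" by linarith
    then show ?thesis
    proof cases
      case 1
      then show ?thesis
        using ent[OF i] i unfolding implicit_entry_def G'
        by (simp add: upd(1,2) y_def hh_vec_def del: sum.op_ivl_Suc)
    next
      \<comment> \<open>Row \<open>k\<close> no longer receives the term with \<open>h\<close>, but
        the same value now sits in \<open>O\<close>; only the unit entry of \<open>y\<close> is
        subtracted, through \<open>G\<close>.\<close>
      case 2
      then show ?thesis
        using xi[of i] i unfolding implicit_entry_def G'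
        by (simp add: upd(1,2) y_def hh_vec_def g_def del: sum.op_ivl_Suc)
    next
      case 3
      have "(if k \<le> i \<and> i \<le> k + l then d * (if i = k then 1 else B $$ (i, k)) else 0) =
          d * B $$ (i, k)"
        using bps_repr_band_zero[OF repr, of k i] i 3 by auto
      note G' = G'[unfolded this]
      show ?thesis
        using xi[of i] i 3 bps_repr_lower_entry[OF repr 3 i] unfolding implicit_entry_def G'
        by (simp add: upd(1,2) y_def hh_vec_def g_def O0 algebra_simps
            sum_subtractf sum_distrib_left del: sum.op_ivl_Suc)
    qed
  qed
  moreover have "apply_reflectors n F tau [0..<Suc k] b $ i = x $ i - d * y $ i" if "i < n" for i
  proof -
    have "apply_reflectors n F tau [0..<Suc k] b = reflector n (tau $ k) y *\<^sub>v x"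
      by (simp add: x_def y_def)
    moreover have "y \<in> carrier_vec n" by (simp add: y_def)
    ultimately show ?thesis
      using that by (simp only: reflector_mult_vec[OF x] d_def)
  qed
  moreover have "run (inner_prog ;; update_prog) s = run update_prog s1"
    by (simp add: run_Seq s1_def)
  \<comment> \<open>The zero patterns for \<open>Suc k\<close> survive, since the new entries lie in
    row \<open>k\<close> of \<open>O\<close> and at \<open>i = k + j\<close> in
    \<open>G\<close>.\<close>
  ultimately show ?thesis
    by (auto simp: loop_inv_def A'_def[symmetric] upd O0 G0 simp del: upt_Suc)
qed

section \<open>Correctness of the whole program and the linear bound\<close>

lemma fast_apply_Qt_correct:
  assumes inp: "input_state n r l B U V tau b s"
    and repr: "bps_repr n r p l m F B U V W S"
    and b: "b \<in> carrier_vec n"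
  shows "output_vec n (run fast_apply_Qt s) = transpose_mat (hh_Q n F tau) *\<^sub>v b"
proof -
  let ?body = "inner_prog ;; update_prog"
  let ?loop = "FOR ''k'' FROM Ic 0 BELOW Iv ''n'' -\<^sub>i Ic 1 DO ?body"
  define s1 where "s1 = run init_prog s"
  define s2 where "s2 = run table_prog s1"
  define s3 where "s3 = run ?loop s2"
  have inp1: "input_state n r l B U V tau b s1"
    unfolding s1_def by (rule input_state_run[OF inp]) (auto simp: init_prog_def)
  have inp2: "input_state n r l B U V tau b s2"
    unfolding s2_def by (rule input_state_run[OF inp1]) (auto simp: table_prog_def)
  have inp3: "input_state n r l B U V tau b s3"
    unfolding s3_def
    by (rule input_state_run[OF inp2]) (auto simp: inner_prog_def update_prog_def)
  have frame2: "arr s2 ''O'' = arr s1 ''O''" "arr s2 ''G'' = arr s1 ''G''" "arr s2 ''h'' = arr s1 ''h''"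
    by (simp_all add: s2_def arr_run_frame table_prog_def)
  have "loop_inv n r l U b F tau (n - 1) (arr s3)"
    unfolding s3_def
  proof (rule run_For_invariant)
    \<comment> \<open>With no reflector applied, all rows of \<open>U\<close> count, but
      \<open>h\<close>, \<open>O\<close> and \<open>G\<close> are zero, so the implicit vector is
      \<open>b\<close>.\<close>
    show "loop_inv n r l U b F tau 0 (arr s2)"
      by (simp add: loop_inv_def implicit_entry_def frame2 run_init[OF inp, folded s1_def])
  next
    fix k s'
    assume k: "k < n - 1" "reg s' ''k'' = k"
      and ag: "agree_off (written_arrs ?body) (insert ''k'' (written_regs ?body)) s2 s'"
      and inv: "loop_inv n r l U b F tau k (arr s')"
    have inp': "input_state n r l B U V tau b s'"
      by (rule input_state_agree_off[OF inp2 ag]) (auto simp: inner_prog_def update_prog_def)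
    \<comment> \<open>The loop body does not write the tables, so their entries are available in
      every iteration.\<close>
    have PT: "arr s' ''P'' = arr s2 ''P''" "arr s' ''T'' = arr s2 ''T''"
      using ag by (simp_all add: agree_off_def inner_prog_def update_prog_def)
    show "loop_inv n r l U b F tau (Suc k) (arr (run ?body s'))"
      by (rule loop_inv_step[OF inp' repr b k(2) _ _ _ inv])
        (use k in \<open>auto simp: PT run_table[OF inp1, folded s2_def]\<close>)
  qed (use inp2 in \<open>auto simp: input_state_def\<close>)
  then have ent: "implicit_entry r l U b (n - 1) (arr s3) i =
      apply_reflectors n F tau [0..<n - 1] b $ i" if "i < n" for i
    using that by (simp add: loop_inv_def)
  have run: "run fast_apply_Qt s = run output_prog s3"
    by (simp only: fast_apply_Qt_def run_Seq s3_def s2_def s1_def)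
  have dim: "dim_vec (apply_reflectors n F tau [0..<n - 1] b) = n"
    using apply_reflectors_carrier[OF b] by (rule carrier_vecD)
  have "output_vec n (run fast_apply_Qt s) = apply_reflectors n F tau [0..<n - 1] b"
  proof (rule eq_vecI)
    show "dim_vec (output_vec n (run fast_apply_Qt s)) =
        dim_vec (apply_reflectors n F tau [0..<n - 1] b)"
      by (simp only: output_vec_def dim_vec dim)
  next
    fix i
    assume "i < dim_vec (apply_reflectors n F tau [0..<n - 1] b)"
    then have i: "i < n" by (simp only: dim)
    \<comment> \<open>At \<open>k = n - 1\<close> the term with \<open>h\<close> is present only in
      the last row, which is the row that \<open>output_prog\<close> corrects.\<close>
    then have "n - 1 \<le> i \<longleftrightarrow> Suc i = n" by auto
    then have "output_vec n (run fast_apply_Qt s) $ i = implicit_entry r l U b (n - 1) (arr s3) i"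
      by (simp only: output_vec_def index_vec[OF i] run run_output[OF inp3 i] implicit_entry_def)
    then show "output_vec n (run fast_apply_Qt s) $ i =
        apply_reflectors n F tau [0..<n - 1] b $ i"
      by (simp only: ent[OF i])
  qed
  then show ?thesis by (simp add: transpose_hh_Q_mult_vec[OF b])
qed

theorem theorem2:
  fixes K :: nat
  shows "\<exists>C :: nat. \<forall>n r p l m A Q R F tau B U V W S b s.
    n \<ge> 1 \<and> r \<le> K \<and> p \<le> K \<and> l \<le> K \<and> m \<le> K \<and>
    A \<in> bps_mats n r p l m \<and>
    householder_qr n A Q R F tau \<and>
    bps_repr n r (r + p) l (l + m) F B U V W S \<and>
    b \<in> carrier_vec n \<and>
    input_state n r l B U V tau b s \<longrightarrow>
      output_vec n (fst (exec fast_apply_Qt s)) = transpose_mat Q *\<^sub>v b \<and>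
      snd (exec fast_apply_Qt s) \<le> C * n"
  proof -
  obtain t u where cost: "\<And>n r l. r \<le> K \<Longrightarrow> l \<le> K \<Longrightarrow> cost_le n r l fast_apply_Qt (t + n * u)"
    using linear_cost_fast_apply_Qt[of K] unfolding linear_cost_def by blast
  show ?thesis
  \<comment> \<open>The additive part \<open>t\<close> of the cost \<open>t + n * u\<close> is
    absorbed by \<open>t * n\<close>, as \<open>n \<ge> 1\<close>.\<close>
  proof (intro exI[of _ "t + u"] allI impI, elim conjE)
    fix n r p l m :: nat and A Q R F :: "real mat" and tau :: "real vec"
      and B U V W S :: "real mat" and b :: "real vec" and s :: state
    assume n: "n \<ge> 1" and K: "r \<le> K" "l \<le> K"
      and qr: "householder_qr n A Q R F tau"
      and repr: "bps_repr n r (r + p) l (l + m) F B U V W S"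
      and b: "b \<in> carrier_vec n"
      and inp: "input_state n r l B U V tau b s"
    have "output_vec n (run fast_apply_Qt s) = transpose_mat Q *\<^sub>v b"
      using fast_apply_Qt_correct[OF inp repr b] qr by (simp add: householder_qr_def)
    moreover have "snd (exec fast_apply_Qt s) \<le> t + n * u"
      using cost[OF K] inp by (simp add: cost_le_def input_state_def)
    moreover have "t + n * u \<le> (t + u) * n"
      using mult_le_mono2[OF n, of t] by (simp add: algebra_simps)
    ultimately show "output_vec n (run fast_apply_Qt s) = transpose_mat Q *\<^sub>v b \<and>
        snd (exec fast_apply_Qt s) \<le> (t + u) * n"
      by linarith
  qed
qed

end
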